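(* Suppose that $n=2^m-1=r_1\cdot r_2$, where $r_1,r_2$ are odd integers such that $\gcd(r_1,r_2)=1$ and $r_1,r_2>1$. Let $\alpha$ be a primitive $n$-th root of unity in the field with $2^m$ elements and let $T:\mathbb{Z}_n\to\mathbb{Z}_{r_1}\times\mathbb{Z}_{r_2}$ be an arbitrary isomorphism of groups. Let $\mathcal{C}^*=R^*(m-2,m)$ and let $a=\mathrm{Ord}_{r_1}(2)$ be the multiplicative order of $2$ modulo $r_1$. Let $\mathcal{D}^*\subseteq\mathbb{Z}_n$ be the defining set of $\mathcal{C}^*$ with respect to $\alpha$, and let $\mathcal{C}\subseteq\mathbb{A}(r_1,r_2)$ be the abelian code with defining set $D(\mathcal{C})=T(\mathcal{D}^* )$. Then $$\Gamma:=\Gamma(\mathcal{C})=\left\{(i_1,i_2)\in\mathbb{Z}_{r_1}\times\mathbb{Z}_{r_2}\;\middle|\; 0\le i_1<a,\ 0\le i_2<\frac{m}{a}\right\},$$ and $T^{-1}(\Gamma)$ is a set of check positions for $R^*(m-2,m)$. Furthermore, $\{0\}\cup\{\alpha^i\mid i\in T^{-1}(\Gamma)\}$ is an information set for $R(1,m)$, and $\{\alpha^i\mid i\in\mathbb{Z}_n,\ i\notin T^{-1}(\Gamma)\}$ is an information set for $R(m-2,m)$.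
   Context: **Reed-Muller codes.** $\mathbb{F}$ is the field with two elements, $G$ is the additive group of the field with $2^m$ elements, $G^*=G\setminus\{0\}$, $n=2^m-1$. Elements of the group algebra $\mathbb{F}G$ are written $\sum_{g\in G}a_gX^g$. For $0\le s\le n$ put $\phi_s(\sum_g a_gX^g)=\sum_g a_g g^s\in G$ (with $0^0=1$). The $2$-weight $\mathrm{wt}(k)$ of a natural number $k$ is the number of ones in its binary expansion. For $0<\rho<m$, the Reed-Muller code $R(\rho,m)\subseteq\mathbb{F}G$ is the affine-invariant code with defining set $\{i\mid 0\le i<2^m-1,\ \mathrm{wt}(i)<m-\rho\}$, i.e. $R(\rho,m)$ is the set of $x\in\mathbb{F}G$ with $\phi_i(x)=0$ for all such $i$. $R^*(\rho,m)$ is the code obtained from $R(\rho,m)$ by puncturing at the position $X^0$. For a primitive $n$-th root of unity $\alpha\in G^*$, $R^*(\rho,m)$ is identified with a cyclic code in $\mathbb{F}[X]/\langle X^n-1\rangle$, the coefficient of $X^{\alpha^i}$ corresponding to the coefficient of $X^i$, $i\in\mathbb{Z}_n$; its defining set with respect to $\alpha$ is $\{s\in\mathbb{Z}_n\mid P(\alpha^s)=0\text{ for all }P\text{ in the code}\}$, which equals $\{0<i<2^m-1\mid \mathrm{wt}(i)<m-\rho\}$. **Information sets.** For a linear code of dimension $k$ with coordinates indexed by a finite set $J$, an information set is a subset $I\subseteq J$ with $|I|=k$ such that the projection of the code onto the coordinates in $I$ is $\mathbb{F}^k$; the complement $J\setminus I$ is called a set of check positions. Codes in $\mathbb{F}G$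 have positions indexed by $G$; $R^*(\rho,m)$, seen as a cyclic code, has positions indexed by $\mathbb{Z}_n$; codes in $\mathbb{A}(r_1,r_2)$ have positions indexed by $\mathbb{Z}_{r_1}\times\mathbb{Z}_{r_2}$. **Abelian codes.** $\mathbb{A}(r_1,r_2)=\mathbb{F}[X_1,X_2]/\langle X_1^{r_1}-1,X_2^{r_2}-1\rangle$; an abelian code is an ideal of it. For fixed primitive $r_i$-th roots of unity $\beta_i$, the defining set of $\mathcal{C}$ is $D(\mathcal{C})=\{(a_1,a_2)\in\mathbb{Z}_{r_1}\times\mathbb{Z}_{r_2}\mid P(\beta_1^{a_1},\beta_2^{a_2})=0\ \forall P\in\mathcal{C}\}$; it determines $\mathcal{C}$. Here the roots are the following: choose integers with $\eta_1r_1+\eta_2r_2=1$, put $\alpha_1=\alpha^{\eta_2r_2}$, $\alpha_2=\alpha^{\eta_1r_1}$, $T(1)=(\delta_1,\delta_2)$ and $\beta_i=\alpha_i^{\delta_i^{-1}}$ (inverse modulo $r_i$). (With this choice, $\mathcal{C}$ is the image of $\mathcal{C}^*$ under $\sum a_iX^i\mapsto\sum b_{jl}X_1^jX_2^l$, $b_{jl}=a_i$ iff $T(i)=(j,l)$.) **The set $\Gamma(\mathcal{C})$.** The $2^\gamma$-cyclotomic coset of $a$ modulo $r$ is $C_{2^\gamma,r}(a)=\{a2^{\gamma i}\mid i\ge0\}\subseteq\mathbb{Z}_r$, and $C_r(a)=C_{2,r}(a)$ (the case $\gamma=1$). The $2$-orbit of $(a_1,a_2)$ is $Q(a_1,a_2)=\{(a_12^i,a_22^i)\mid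 i\ge0\}$; $D(\mathcal{C})$ is a union of $2$-orbits. Let $\overline D\subseteq D(\mathcal{C})$ be a set of restricted representatives: it contains exactly one element of each $2$-orbit in $D(\mathcal{C})$, and its projection $\overline D_1$ to the first coordinate contains exactly one element of each $2$-cyclotomic coset modulo $r_1$ in the first projection of $D(\mathcal{C})$. Put $m(e_1)=|C_{r_1}(e_1)|$, $m(e_1,e_2)=|C_{2^{m(e_1)},r_2}(e_2)|$, and for $e_1\in\overline D_1$, $M(e_1)=\sum_{e_2:(e_1,e_2)\in\overline D}m(e_1,e_2)$. Let $f_1>\dots>f_s>0$ be the distinct values of $M$ on $\overline D_1$, $f_{s+1}=0$, and $g_i=\sum_{e_1\in\overline D_1,\,M(e_1)\ge f_i}m(e_1)$. Elements of $\mathbb{Z}_{r_i}$ are identified with integers in $\{0,\dots,r_i-1\}$. Then $\Gamma(\mathcal{C})=\{(i_1,i_2)\in\mathbb{Z}_{r_1}\times\mathbb{Z}_{r_2}\mid\exists\,1\le j\le s:\ f_{j+1}\le i_2<f_j,\ 0\le i_1<g_j\}$. *)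

theory Defs
  imports
    Complex_Main
    "HOL-Library.Z2"
    "HOL-Library.Function_Algebras"
    "HOL-Library.FuncSet"
    "HOL-Algebra.Elementary_Groups"
    "HOL-Algebra.Ideal"
    "HOL-Number_Theory.Number_Theory"
begin

text \<open>
  The two-element field is the library type \<^typ>\<open>bit\<close>.  A word with positions in a set \<open>J\<close>
  is a function to \<^typ>\<open>bit\<close> that vanishes outside \<open>J\<close>, so that the words with
  positions in \<open>J\<close> form a vector space.
\<close>

definition words :: "'j set \<Rightarrow> ('j \<Rightarrow> bit) set" where
  "words J = {x. \<forall>j. j \<notin> J \<longrightarrow> x j = 0}"

abbreviation (input) scale_word :: "bit \<Rightarrow> ('j \<Rightarrow> bit) \<Rightarrow> ('j \<Rightarrow> bit)" where
  "scale_word c x \<equiv> (\<lambda>j. c * x j)"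

lemma vector_space_words: "vector_space (scale_word :: bit \<Rightarrow> ('j \<Rightarrow> bit) \<Rightarrow> _)"
  by unfold_locales (auto simp: fun_eq_iff algebra_simps)

definition code_dim :: "('j \<Rightarrow> bit) set \<Rightarrow> nat" where
  "code_dim C = vector_space.dim scale_word C"

definition information_set :: "'j set \<Rightarrow> ('j \<Rightarrow> bit) set \<Rightarrow> 'j set \<Rightarrow> bool" where
  "information_set J C I \<longleftrightarrow>
     I \<subseteq> J \<and> card I = code_dim C \<and> (\<lambda>x. restrict x I) ` C = I \<rightarrow>\<^sub>E UNIV"

definition check_positions :: "'j set \<Rightarrow> ('j \<Rightarrow> bit) set \<Rightarrow> 'j set \<Rightarrow> bool" where
  "check_positions J C K \<longleftrightarrow> K \<subseteq> J \<and> information_set J C (J - K)"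

text \<open>
  Throughout, \<^typ>\<open>'a\<close> is the field with \<open>2 ^ m\<close> elements.  An element of the group algebra of
  its additive group is its coefficient function, of type \<^typ>\<open>'a \<Rightarrow> bit\<close>.
  In characteristic 2 the following map is the embedding of the prime field.
\<close>

definition of_bit :: "bit \<Rightarrow> 'a::field" where
  "of_bit b = of_bool (b = 1)"

definition primitive_root_of_unity :: "nat \<Rightarrow> 'a::field \<Rightarrow> bool" where
  "primitive_root_of_unity n \<alpha> \<longleftrightarrow> 0 < n \<and> \<alpha> ^ n = 1 \<and> (\<forall>k. 0 < k \<and> k < n \<longrightarrow> \<alpha> ^ k \<noteq> 1)"

definition wt :: "nat \<Rightarrow> nat" where
  "wt k = card {i. bit k i}"

definition phi :: "nat \<Rightarrow> ('a::{finite,field} \<Rightarrow> bit) \<Rightarrow> 'a" where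
  "phi s x = (\<Sum>g\<in>UNIV. of_bit (x g) * g ^ s)"

definition RM :: "nat \<Rightarrow> nat \<Rightarrow> ('a::{finite,field} \<Rightarrow> bit) set" where
  "RM \<rho> m = {x. \<forall>i. i < 2 ^ m - 1 \<and> wt i < m - \<rho> \<longrightarrow> phi i x = 0}"

definition punctured_RM :: "nat \<Rightarrow> nat \<Rightarrow> ('a::{finite,field} \<Rightarrow> bit) set" where
  "punctured_RM \<rho> m = (\<lambda>x. x(0 := 0)) ` RM \<rho> m"

text \<open>
  Residues modulo \<open>n\<close> are the integers in \<open>{0..<n}\<close>, the carrier of
  \<^term>\<open>integer_mod_group n\<close>.  An element of \<open>F[X]/(X^n - 1)\<close> is the word of its coefficients,
  with positions in \<open>{0..<n}\<close>.
\<close>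

abbreviation Zmod :: "nat \<Rightarrow> int set" where
  "Zmod n \<equiv> {0..<int n}"

definition to_cyclic :: "nat \<Rightarrow> 'a::field \<Rightarrow> ('a \<Rightarrow> bit) \<Rightarrow> (int \<Rightarrow> bit)" where
  "to_cyclic n \<alpha> x = (\<lambda>i. if i \<in> Zmod n then x (\<alpha> powi i) else 0)"

definition poly_eval :: "nat \<Rightarrow> (int \<Rightarrow> bit) \<Rightarrow> 'a::field \<Rightarrow> 'a" where
  "poly_eval n P z = (\<Sum>i\<in>Zmod n. of_bit (P i) * z powi i)"

definition cyclic_defining_set :: "nat \<Rightarrow> 'a::field \<Rightarrow> (int \<Rightarrow> bit) set \<Rightarrow> int set" where
  "cyclic_defining_set n \<alpha> C = {s \<in> Zmod n. \<forall>P\<in>C. poly_eval n P (\<alpha> powi s) = 0}"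

text \<open>
  An element of \<open>F[X\<^sub>1,X\<^sub>2]/(X\<^sub>1^r\<^sub>1 - 1, X\<^sub>2^r\<^sub>2 - 1)\<close> is the word of coefficients of its
  representative of degree less than \<open>r\<^sub>i\<close> in \<open>X\<^sub>i\<close>.  Monomials multiply by adding exponents
  modulo \<open>r\<^sub>1\<close> and \<open>r\<^sub>2\<close>, so the ring is the group algebra of \<open>Z/r\<^sub>1 \<times> Z/r\<^sub>2\<close>.
  The multiplication below is this convolution.  The library's \<^const>\<open>ideal\<close> demands
  that the ambient structure be a ring, which \<open>cring_abelian_alg\<close> provides.
\<close>

definition group_alg :: "('g, 'b) monoid_scheme \<Rightarrow> ('g \<Rightarrow> bit) ring" where
  "group_alg G =
     \<lparr>carrier = words (carrier G),
      mult = (\<lambda>P Q k. \<Sum>i\<in>carrier G. \<Sum>j\<in>carrier G. of_bool (i \<otimes>\<^bsub>G\<^esub> j = k) * (P i * Q j)),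
      one = (\<lambda>k. of_bool (k = \<one>\<^bsub>G\<^esub>)),
      zero = (\<lambda>k. 0),
      add = (\<lambda>P Q k. P k + Q k)\<rparr>"

definition abelian_alg :: "nat \<Rightarrow> nat \<Rightarrow> (int \<times> int \<Rightarrow> bit) ring" where
  "abelian_alg r1 r2 = group_alg (integer_mod_group r1 \<times>\<times> integer_mod_group r2)"

lemma group_alg_conv:
  assumes "group G" "finite (carrier G)"
  shows "(\<Sum>k\<in>carrier G. (P \<otimes>\<^bsub>group_alg G\<^esub> Q) k * h k)
       = (\<Sum>i\<in>carrier G. \<Sum>j\<in>carrier G. P i * (Q j * h (i \<otimes>\<^bsub>G\<^esub> j)))"
proof -
  interpret group G by fact
  have "(\<Sum>k\<in>carrier G. (P \<otimes>\<^bsub>group_alg G\<^esub> Q) k * h k)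
      = (\<Sum>k\<in>carrier G. \<Sum>i\<in>carrier G. \<Sum>j\<in>carrier G.
           of_bool (i \<otimes>\<^bsub>G\<^esub> j = k) * (P i * Q j) * h k)"
    by (simp only: group_alg_def monoid.simps sum_distrib_right)
  also have "\<dots> = (\<Sum>i\<in>carrier G. \<Sum>k\<in>carrier G. \<Sum>j\<in>carrier G.
           of_bool (i \<otimes>\<^bsub>G\<^esub> j = k) * (P i * Q j) * h k)"
    by (rule sum.swap)
  also have "\<dots> = (\<Sum>i\<in>carrier G. \<Sum>j\<in>carrier G. \<Sum>k\<in>carrier G.
           of_bool (i \<otimes>\<^bsub>G\<^esub> j = k) * (P i * Q j) * h k)"
    by (intro sum.cong refl sum.swap)
  also have "\<dots> = (\<Sum>i\<in>carrier G. \<Sum>j\<in>carrier G. P i * (Q j * h (i \<otimes>\<^bsub>G\<^esub> j)))"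
  proof (intro sum.cong refl)
    fix i j assume "i \<in> carrier G" "j \<in> carrier G"
    then have "i \<otimes>\<^bsub>G\<^esub> j \<in> carrier G" by simp
    have "(\<Sum>k\<in>carrier G. of_bool (i \<otimes>\<^bsub>G\<^esub> j = k) * (P i * Q j) * h k)
        = (\<Sum>k\<in>carrier G. if i \<otimes>\<^bsub>G\<^esub> j = k then P i * (Q j * h k) else 0)"
      by (intro sum.cong) (auto simp: mult.assoc)
    also have "\<dots> = P i * (Q j * h (i \<otimes>\<^bsub>G\<^esub> j))"
      using assms(2) \<open>i \<otimes>\<^bsub>G\<^esub> j \<in> carrier G\<close> by (subst sum.delta') auto
    finally show "(\<Sum>k\<in>carrier G. of_bool (i \<otimes>\<^bsub>G\<^esub> j = k) * (P i * Q j) * h k)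
        = P i * (Q j * h (i \<otimes>\<^bsub>G\<^esub> j))" .
  qed
  finally show ?thesis .
qed

lemma group_alg_mult_alt:
  "(P \<otimes>\<^bsub>group_alg G\<^esub> Q) k
     = (\<Sum>i\<in>carrier G. P i * (\<Sum>j\<in>carrier G. Q j * of_bool (i \<otimes>\<^bsub>G\<^esub> j = k)))"
  by (simp only: group_alg_def monoid.simps sum_distrib_left) (simp only: ac_simps)

lemma cring_group_alg:
  assumes "comm_group G" "finite (carrier G)"
  shows "cring (group_alg G)"
proof -
  interpret G: comm_group G by fact
  let ?A = "group_alg G"
  have com: "P \<otimes>\<^bsub>?A\<^esub> Q = Q \<otimes>\<^bsub>?A\<^esub> P" for P Q
  proof
    fix k
    have "(P \<otimes>\<^bsub>?A\<^esub> Q) k =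
        (\<Sum>j\<in>carrier G. \<Sum>i\<in>carrier G. of_bool (i \<otimes>\<^bsub>G\<^esub> j = k) * (P i * Q j))"
      unfolding group_alg_def monoid.simps by (rule sum.swap)
    also have "\<dots> = (Q \<otimes>\<^bsub>?A\<^esub> P) k"
      unfolding group_alg_def monoid.simps
      by (intro sum.cong refl) (simp only: G.m_comm mult.commute)
    finally show "(P \<otimes>\<^bsub>?A\<^esub> Q) k = (Q \<otimes>\<^bsub>?A\<^esub> P) k" .
  qed
  have assoc: "(P \<otimes>\<^bsub>?A\<^esub> Q) \<otimes>\<^bsub>?A\<^esub> R = P \<otimes>\<^bsub>?A\<^esub> (Q \<otimes>\<^bsub>?A\<^esub> R)" for P Q R
  proof
    fix k
    have "((P \<otimes>\<^bsub>?A\<^esub> Q) \<otimes>\<^bsub>?A\<^esub> R) k =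
       (\<Sum>i\<in>carrier G. \<Sum>j\<in>carrier G. P i *
          (Q j * (\<Sum>l\<in>carrier G. R l * of_bool (i \<otimes>\<^bsub>G\<^esub> j \<otimes>\<^bsub>G\<^esub> l = k))))"
      by (subst group_alg_mult_alt) (rule group_alg_conv[OF G.is_group assms(2)])
    also have "\<dots> = (\<Sum>i\<in>carrier G. P i *
          (\<Sum>j\<in>carrier G. \<Sum>l\<in>carrier G. Q j * (R l * of_bool (i \<otimes>\<^bsub>G\<^esub> (j \<otimes>\<^bsub>G\<^esub> l) = k))))"
      unfolding sum_distrib_left by (intro sum.cong refl) (simp only: G.m_assoc)
    also have "\<dots> = (P \<otimes>\<^bsub>?A\<^esub> (Q \<otimes>\<^bsub>?A\<^esub> R)) k"
      by (subst group_alg_mult_alt, subst group_alg_conv[OF G.is_group assms(2)]) (rule refl)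
    finally show "((P \<otimes>\<^bsub>?A\<^esub> Q) \<otimes>\<^bsub>?A\<^esub> R) k = (P \<otimes>\<^bsub>?A\<^esub> (Q \<otimes>\<^bsub>?A\<^esub> R)) k" .
  qed
  have closed: "P \<otimes>\<^bsub>?A\<^esub> Q \<in> carrier ?A" for P Q
    by (auto simp: group_alg_def words_def intro!: sum.neutral)
  have one: "\<one>\<^bsub>?A\<^esub> \<otimes>\<^bsub>?A\<^esub> P = P" if "P \<in> carrier ?A" for P
  proof
    fix k
    have "(\<one>\<^bsub>?A\<^esub> \<otimes>\<^bsub>?A\<^esub> P) k =
       (\<Sum>i\<in>carrier G. if i = \<one>\<^bsub>G\<^esub> then \<Sum>j\<in>carrier G. P j * of_bool (i \<otimes>\<^bsub>G\<^esub> j = k) else 0)"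
      by (subst group_alg_mult_alt, intro sum.cong refl) (simp add: group_alg_def)
    also have "\<dots> = (\<Sum>j\<in>carrier G. P j * of_bool (\<one>\<^bsub>G\<^esub> \<otimes>\<^bsub>G\<^esub> j = k))"
      by (simp only: sum.delta[OF assms(2)] G.one_closed if_True)
    also have "\<dots> = (\<Sum>j\<in>carrier G. if j = k then P j else 0)"
      by (intro sum.cong refl) simp
    also have "\<dots> = P k"
      using that assms(2) by (simp add: group_alg_def words_def)
    finally show "(\<one>\<^bsub>?A\<^esub> \<otimes>\<^bsub>?A\<^esub> P) k = P k" .
  qed
  have distr: "(P \<oplus>\<^bsub>?A\<^esub> Q) \<otimes>\<^bsub>?A\<^esub> R = P \<otimes>\<^bsub>?A\<^esub> R \<oplus>\<^bsub>?A\<^esub> Q \<otimes>\<^bsub>?A\<^esub> R" for P Q R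
    unfolding group_alg_def
    by (simp only: monoid.simps ring.simps distrib_left distrib_right sum.distrib)
  have zero_closed: "\<zero>\<^bsub>?A\<^esub> \<in> carrier ?A" and one_closed: "\<one>\<^bsub>?A\<^esub> \<in> carrier ?A"
    and add_closed: "\<And>P Q. P \<in> carrier ?A \<Longrightarrow> Q \<in> carrier ?A \<Longrightarrow> P \<oplus>\<^bsub>?A\<^esub> Q \<in> carrier ?A"
    by (auto simp: group_alg_def words_def)
  have add: "\<And>P. \<zero>\<^bsub>?A\<^esub> \<oplus>\<^bsub>?A\<^esub> P = P" "\<And>P. P \<oplus>\<^bsub>?A\<^esub> P = \<zero>\<^bsub>?A\<^esub>"
    by (simp_all add: group_alg_def fun_eq_iff)
  have add_ac: "P \<oplus>\<^bsub>?A\<^esub> Q = Q \<oplus>\<^bsub>?A\<^esub> P"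
    "P \<oplus>\<^bsub>?A\<^esub> Q \<oplus>\<^bsub>?A\<^esub> R = P \<oplus>\<^bsub>?A\<^esub> (Q \<oplus>\<^bsub>?A\<^esub> R)" for P Q R
    unfolding group_alg_def by (simp_all only: ring.simps ac_simps)
  show ?thesis
    by (intro cringI abelian_groupI comm_monoidI)
      (use closed one_closed zero_closed add_closed add add_ac com assoc one distr in \<open>blast+\<close>)
qed

lemma cring_abelian_alg:
  assumes "0 < r1" "0 < r2"
  shows "cring (abelian_alg r1 r2)"
proof -
  have g: "group (integer_mod_group r1 \<times>\<times> integer_mod_group r2)"
    by (intro DirProd_group) auto
  then have "comm_group (integer_mod_group r1 \<times>\<times> integer_mod_group r2)"
    by (rule group.group_comm_groupI) (auto simp: add.commute)
  then show ?thesis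
    unfolding abelian_alg_def using assms
    by (intro cring_group_alg) (auto simp: carrier_integer_mod_group)
qed

definition abelian_code :: "nat \<Rightarrow> nat \<Rightarrow> (int \<times> int \<Rightarrow> bit) set \<Rightarrow> bool" where
  "abelian_code r1 r2 C \<longleftrightarrow> ideal C (abelian_alg r1 r2)"

definition poly_eval2 ::
  "nat \<Rightarrow> nat \<Rightarrow> (int \<times> int \<Rightarrow> bit) \<Rightarrow> 'a::field \<Rightarrow> 'a \<Rightarrow> 'a" where
  "poly_eval2 r1 r2 P z1 z2 =
     (\<Sum>(j, l)\<in>Zmod r1 \<times> Zmod r2. of_bit (P (j, l)) * z1 powi j * z2 powi l)"

definition defining_set ::
  "nat \<Rightarrow> nat \<Rightarrow> 'a::field \<Rightarrow> 'a \<Rightarrow> (int \<times> int \<Rightarrow> bit) set \<Rightarrow> (int \<times> int) set" where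
  "defining_set r1 r2 \<beta>1 \<beta>2 C =
     {(a1, a2) \<in> Zmod r1 \<times> Zmod r2. \<forall>P\<in>C. poly_eval2 r1 r2 P (\<beta>1 powi a1) (\<beta>2 powi a2) = 0}"

definition cyclo_coset :: "nat \<Rightarrow> nat \<Rightarrow> int \<Rightarrow> int set" where
  "cyclo_coset \<gamma> r a = {(a * 2 ^ (\<gamma> * i)) mod int r | i. True}"

definition orbit2 :: "nat \<Rightarrow> nat \<Rightarrow> int \<times> int \<Rightarrow> (int \<times> int) set" where
  "orbit2 r1 r2 d = {((fst d * 2 ^ i) mod int r1, (snd d * 2 ^ i) mod int r2) | i::nat. True}"

definition restricted_reps ::
  "nat \<Rightarrow> nat \<Rightarrow> (int \<times> int) set \<Rightarrow> (int \<times> int) set \<Rightarrow> bool" where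
  "restricted_reps r1 r2 D Dbar \<longleftrightarrow>
     Dbar \<subseteq> D \<and>
     (\<forall>d\<in>D. \<exists>!e. e \<in> Dbar \<and> e \<in> orbit2 r1 r2 d) \<and>
     (\<forall>a\<in>fst ` D. \<exists>!b. b \<in> fst ` Dbar \<and> b \<in> cyclo_coset 1 r1 a)"

definition m1 :: "nat \<Rightarrow> int \<Rightarrow> nat" where
  "m1 r1 e1 = card (cyclo_coset 1 r1 e1)"

definition m2 :: "nat \<Rightarrow> nat \<Rightarrow> int \<Rightarrow> int \<Rightarrow> nat" where
  "m2 r1 r2 e1 e2 = card (cyclo_coset (m1 r1 e1) r2 e2)"

definition M_val :: "nat \<Rightarrow> nat \<Rightarrow> (int \<times> int) set \<Rightarrow> int \<Rightarrow> nat" where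
  "M_val r1 r2 Dbar e1 = (\<Sum>e2 | (e1, e2) \<in> Dbar. m2 r1 r2 e1 e2)"

text \<open>
  \<open>f_seq r1 r2 Dbar\<close> is the decreasing list \<open>f\<^sub>1 > \<dots> > f\<^sub>s\<close>; \<open>f_val\<close> and \<open>g_val\<close>
  use the indices \<open>1, \<dots>, s\<close>, and \<open>f_val\<close> is 0 at \<open>s + 1\<close>.
\<close>

definition f_seq :: "nat \<Rightarrow> nat \<Rightarrow> (int \<times> int) set \<Rightarrow> nat list" where
  "f_seq r1 r2 Dbar = rev (sorted_list_of_set (M_val r1 r2 Dbar ` (fst ` Dbar)))"

definition f_val :: "nat \<Rightarrow> nat \<Rightarrow> (int \<times> int) set \<Rightarrow> nat \<Rightarrow> nat" where
  "f_val r1 r2 Dbar j =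
     (if 1 \<le> j \<and> j \<le> length (f_seq r1 r2 Dbar) then f_seq r1 r2 Dbar ! (j - 1) else 0)"

definition g_val :: "nat \<Rightarrow> nat \<Rightarrow> (int \<times> int) set \<Rightarrow> nat \<Rightarrow> nat" where
  "g_val r1 r2 Dbar j =
     (\<Sum>e1 | e1 \<in> fst ` Dbar \<and> f_val r1 r2 Dbar j \<le> M_val r1 r2 Dbar e1. m1 r1 e1)"

definition Gamma_set :: "nat \<Rightarrow> nat \<Rightarrow> (int \<times> int) set \<Rightarrow> (int \<times> int) set" where
  "Gamma_set r1 r2 Dbar =
     {(i1, i2) \<in> Zmod r1 \<times> Zmod r2.
        \<exists>j. 1 \<le> j \<and> j \<le> length (f_seq r1 r2 Dbar) \<and>
            int (f_val r1 r2 Dbar (j + 1)) \<le> i2 \<and> i2 < int (f_val r1 r2 Dbar j) \<and>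
            0 \<le> i1 \<and> i1 < int (g_val r1 r2 Dbar j)}"

end

theory Submission
  imports
    Defs
    "HOL-Computational_Algebra.Polynomial"
    "HOL-Library.Product_Plus"
begin

text \<open>
  The code \<open>R(m-2,m)\<close> is the extended Hamming code, given by the two checks \<open>\<Sum> x\<^sub>g = 0\<close> and
  \<open>\<Sum> x\<^sub>g g = 0\<close>, because \<open>\<phi>\<close> at \<open>2 ^ k\<close> is a Frobenius power of \<open>\<phi>\<close> at \<open>1\<close>.  Hence the defining set of
  \<open>R\<^sup>*(m-2,m)\<close> consists of the powers of 2 and is a single 2-orbit, which makes \<open>\<Gamma>\<close> an
  \<open>a \<times> m/a\<close> rectangle.  The locators \<open>\<alpha> ^ i\<close> with \<open>T i \<in> \<Gamma>\<close> are the products \<open>\<gamma>1 ^ i\<^sub>1 * \<gamma>2 ^ i\<^sub>2\<close> over this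
  rectangle, where \<open>\<gamma>1\<close>, \<open>\<gamma>2\<close> have orders \<open>r\<^sub>1\<close>, \<open>r\<^sub>2\<close>; they form a basis of the field over
  \<open>F\<^sub>2\<close>, so the check equations can be solved uniquely at these positions.  Finally \<open>R(1,m)\<close>
  consists of the affine functions, the linear ones being the maps \<open>g \<mapsto> Tr (c g)\<close>, and an affine
  function is determined by its arbitrary values at 0 and on a basis.
\<close>

section \<open>Codes and information sets\<close>

lemma sum_fun_apply: "(\<Sum>i\<in>I. f i) k = (\<Sum>i\<in>I. f i k)"
  by (induction I rule: infinite_finite_induct) simp_all

lemma word_add_eq_0:
  fixes x y :: "'j \<Rightarrow> bit"
  assumes "x + y = 0"
  shows "x = y"
proof
  fix j
  have *: "a + b = 0 \<Longrightarrow> a = b" for a b :: bit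
    by (cases a; cases b) simp_all
  have "x j + y j = 0"
    using assms by (metis plus_fun_apply zero_fun_apply)
  then show "x j = y j"
    by (rule *)
qed

text \<open>Unique interpolation on \<open>I\<close> yields a systematic basis of \<open>C\<close>,
  whose size is the dimension that \<open>information_set\<close> demands. With only two scalars,
  closure under addition and the zero word already make \<open>C\<close> a subspace.\<close>

lemma information_setI:
  assumes "finite I" "I \<subseteq> J"
    and add: "\<And>x y. x \<in> C \<Longrightarrow> y \<in> C \<Longrightarrow> x + y \<in> C"
    and inj: "\<And>x. x \<in> C \<Longrightarrow> (\<And>i. i \<in> I \<Longrightarrow> x i = 0) \<Longrightarrow> x = 0"
    and surj: "\<And>y. \<exists>x\<in>C. \<forall>i\<in>I. x i = y i"
  shows "information_set J C I"
proof -
  interpret vector_space "scale_word :: bit \<Rightarrow> ('a \<Rightarrow> bit) \<Rightarrow> _"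
    by (rule vector_space_words)
  have sub: "subspace C"
  proof (rule subspaceI)
    \<comment> \<open>The zero word is obtained as the interpolant of the zero values, which
      \<open>inj\<close> identifies.\<close>
    obtain z where "z \<in> C" "\<forall>i\<in>I. z i = 0"
      using surj[of "\<lambda>_. 0"] by auto
    moreover from this have "z = 0"
      by (intro inj) auto
    ultimately show zero: "0 \<in> C" by simp
    show "(\<lambda>j. c * x j) \<in> C" if "x \<in> C" for c x
    proof (cases "c = 0")
      case True
      with zero show ?thesis by (simp add: zero_fun_def)
    next
      case False
      then have "c = 1" by simp
      then have "(\<lambda>j. c * x j) = x" by (simp only: mult_1_left)
      with that show ?thesis by (simp only:)
    qed
  qed (use add in auto)
  \<comment> \<open>The words \<open>e i\<close> are the rows of a systematic generator matrix: unit
    vectors on \<open>I\<close>.\<close>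
  have "\<exists>x. x \<in> C \<and> (\<forall>j\<in>I. x j = of_bool (j = i))" for i
    using surj[of "\<lambda>j. of_bool (j = i)"] by blast
  then obtain e where "\<And>i. e i \<in> C \<and> (\<forall>j\<in>I. e i j = of_bool (j = i))"
    by metis
  then have e: "e i \<in> C" "j \<in> I \<Longrightarrow> e i j = of_bool (j = i)" for i j
    by blast+
  have inj_e: "inj_on e I"
  proof (rule inj_onI)
    fix i j assume ij: "i \<in> I" "j \<in> I" "e i = e j"
    have "of_bool (i = j) = e j i"
      using ij(1) by (rule e(2)[symmetric])
    also have "\<dots> = e i i"
      by (simp only: ij(3))
    also have "\<dots> = 1"
      using ij(1) by (simp add: e(2))
    finally show "i = j"
      by (simp split: if_splits)
  qed
  define comb where "comb c = (\<Sum>i\<in>I. (\<lambda>j. c i * e i j))" for c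
  have comb_apply: "comb c k = c k" if "k \<in> I" for c k
  proof -
    have "comb c k = (\<Sum>i\<in>I. c i * e i k)"
      unfolding comb_def by (rule sum_fun_apply)
    also have "\<dots> = (\<Sum>i\<in>I. if i = k then c i else 0)"
      using that by (intro sum.cong refl) (simp add: e(2))
    finally show ?thesis
      using that assms(1) by simp
  qed
  have comb_C: "comb c \<in> C" for c
    unfolding comb_def by (intro subspace_sum[OF sub] subspace_scale[OF sub] e)
  have "dim C = card I"
  proof (rule dim_unique)
    show "e ` I \<subseteq> C" using e by auto
    show "C \<subseteq> span (e ` I)"
    proof
      fix x assume x: "x \<in> C"
      \<comment> \<open>In characteristic 2 the sum is a difference, and it vanishes on
        \<open>I\<close>.\<close>
      have "x + comb x = 0"
        using x by (intro inj add comb_C) (simp_all add: comb_apply)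
      then have "x = comb x"
        by (rule word_add_eq_0)
      also have "comb x \<in> span (e ` I)"
        unfolding comb_def by (intro span_sum span_scale span_base) auto
      finally show "x \<in> span (e ` I)" .
    qed
    show "independent (e ` I)"
    proof (rule independent_if_scalars_zero)
      fix f x
      assume *: "(\<Sum>x\<in>e ` I. (\<lambda>j. f x * x j)) = 0" "x \<in> e ` I"
      then obtain k where k: "k \<in> I" "x = e k" by blast
      have "comb (\<lambda>i. f (e i)) = 0"
        using *(1) unfolding comb_def sum.reindex[OF inj_e] comp_def .
      with comb_apply[OF k(1), of "\<lambda>i. f (e i)"] k(2) show "f x = 0"
        by simp
    qed (use assms in auto)
    show "card (e ` I) = card I"
      by (rule card_image[OF inj_e])
  qed
  moreover have "(\<lambda>x. restrict x I) ` C = I \<rightarrow>\<^sub>E UNIV"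
  proof (intro equalityI subsetI)
    fix y assume y: "y \<in> I \<rightarrow>\<^sub>E (UNIV :: bit set)"
    obtain x where "x \<in> C" "\<forall>i\<in>I. x i = y i"
      using surj by blast
    then have "y = restrict x I"
      by (intro ext) (metis PiE_arb restrict_apply y)
    with \<open>x \<in> C\<close> show "y \<in> (\<lambda>x. restrict x I) ` C" by blast
  qed auto
  ultimately show ?thesis
    using assms(2) by (simp add: information_set_def code_dim_def)
qed

text \<open>Read \<open>\<sigma>\<close> as a syndrome. Values prescribed outside \<open>K\<close>
  have some syndrome, and exactly one word on \<open>K\<close> cancels it.\<close>

lemma information_set_kernel:
  fixes \<sigma> :: "('j \<Rightarrow> bit) \<Rightarrow> 'v::ab_group_add"
  assumes "finite J" "K \<subseteq> J"
    and add: "\<And>x y. \<sigma> (x + y) = \<sigma> x + \<sigma> y"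
    and ex1: "\<And>v. \<exists>!z. z \<in> words K \<and> \<sigma> z = v"
  shows "information_set J {x \<in> words J. \<sigma> x = 0} (J - K)"
proof (rule information_setI)
  have zero: "\<sigma> 0 = 0"
    using add[of 0 0] by simp
  fix x assume "x \<in> {x \<in> words J. \<sigma> x = 0}" "\<And>i. i \<in> J - K \<Longrightarrow> x i = 0"
  then have "x \<in> words K \<and> \<sigma> x = 0"
    by (auto simp: words_def)
  moreover have "0 \<in> words K \<and> \<sigma> 0 = 0"
    by (simp add: zero words_def)
  ultimately show "x = 0"
    using ex1[of 0] by blast
next
  fix y :: "'j \<Rightarrow> bit"
  define y' where "y' = (\<lambda>j. if j \<in> J - K then y j else 0)"
  obtain z where z: "z \<in> words K" "\<sigma> z = - \<sigma> y'"
    using ex1 by blast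
  with assms(2) have "y' + z \<in> {x \<in> words J. \<sigma> x = 0}" "\<forall>i\<in>J - K. (y' + z) i = y i"
    by (auto simp: add y'_def words_def)
  then show "\<exists>x\<in>{x \<in> words J. \<sigma> x = 0}. \<forall>i\<in>J - K. x i = y i"
    by blast
qed (use assms in \<open>auto simp: add words_def\<close>)

lemma card_words:
  assumes "finite K"
  shows "card (words K) = 2 ^ card K" "finite (words K)"
proof -
  have bij: "bij_betw (\<lambda>x. {j. x j = 1}) (words K) (Pow K)"
    by (rule bij_betw_byWitness[where f' = "\<lambda>A j. of_bool (j \<in> A)"])
      (auto simp: words_def fun_eq_iff)
  then show "card (words K) = 2 ^ card K" "finite (words K)"
    using bij_betw_same_card[OF bij] bij_betw_finite[OF bij] assms by (auto simp: card_Pow)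
qed

lemma poly_function_eq_0:
  fixes c :: "nat \<Rightarrow> 'a::idom"
  assumes "finite A" "d \<le> card A"
    and "\<And>x. x \<in> A \<Longrightarrow> (\<Sum>i<d. c i * x ^ i) = 0" and "i < d"
  shows "c i = 0"
proof -
  define p where "p = (\<Sum>i<d. Polynomial.monom (c i) i)"
  have coeff: "poly.coeff p j = (if j < d then c j else 0)" for j
    by (simp add: p_def coeff_sum)
  then have "degree p < card A"
    using assms by (intro le_less_trans[OF degree_le[of "d - 1"]]) auto
  then have "p = 0"
    using assms by (intro poly_eqI_degree[of A]) (auto simp: p_def poly_sum poly_monom)
  then show ?thesis
    using coeff[of i] assms by simp
qed

section \<open>Fields with \<open>2 ^ m\<close> elements\<close>

lemma of_bit_simps [simp]:
  "of_bit 0 = (0 :: 'a::field)" "of_bit 1 = (1 :: 'a::field)"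
  "of_bit b = (0 :: 'a::field) \<longleftrightarrow> b = 0"
  "k > 0 \<Longrightarrow> of_bit b ^ k = (of_bit b :: 'a::field)"
  by (auto simp: of_bit_def)

locale binary_field =
  fixes \<alpha> :: "'a::{finite,field}" and m n :: nat
  assumes card_UNIV_field: "card (UNIV :: 'a set) = 2 ^ m"
    and n_eq: "n = 2 ^ m - 1"
    and root: "primitive_root_of_unity n \<alpha>"
    and m_ge_2: "2 \<le> m"
begin

lemma Suc_n: "Suc n = 2 ^ m"
  using n_eq by simp

lemma card_nonzero: "card (UNIV - {0 :: 'a}) = n"
  by (simp add: card_Diff_singleton card_UNIV_field flip: Suc_n)

lemma n_gt_2: "n > 2"
proof -
  have "(2::nat) ^ 2 \<le> 2 ^ m"
    using m_ge_2 by (intro power_increasing) auto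
  then show ?thesis
    using n_eq by simp
qed

lemma CHAR_eq_2: "CHAR('a) = 2"
proof -
  have "prime CHAR('a)"
    by (intro prime_CHAR_semidom finite_imp_CHAR_pos) auto
  moreover from this have "CHAR('a) dvd 2"
    using CHAR_dvd_CARD[where ?'a = 'a] by (auto simp: card_UNIV_field intro: prime_dvd_power)
  ultimately show ?thesis
    by (simp add: primes_dvd_imp_eq)
qed

lemma two_eq_0: "(2 :: 'a) = 0"
  using of_nat_CHAR[where ?'a = 'a] by (simp add: CHAR_eq_2)

lemma add_self [simp]: "x + x = (0 :: 'a)"
  using two_eq_0 by (metis mult_2 mult_zero_left)

lemma minus_eq [simp]: "- x = (x :: 'a)"
  by (rule minus_unique) simp

lemma of_bit_add: "of_bit (a + b) = (of_bit a + of_bit b :: 'a)"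
  by (cases "a = 0"; cases "b = 0") auto

lemma frobenius_add: "(x + y :: 'a) ^ 2 ^ k = x ^ 2 ^ k + y ^ 2 ^ k"
  by (rule freshmans_dream') (simp_all add: CHAR_eq_2)

lemma frobenius_sum: "(sum f A :: 'a) ^ 2 ^ k = (\<Sum>i\<in>A. f i ^ 2 ^ k)"
  by (rule freshmans_dream_sum') (simp_all add: CHAR_eq_2)

lemma root_nonzero [simp]: "\<alpha> \<noteq> 0"
  using root n_gt_2 by (auto simp: primitive_root_of_unity_def power_0_left)

lemma root_powi_mod: "\<alpha> powi (i mod int n) = \<alpha> powi i"
proof -
  have "\<alpha> powi i = \<alpha> powi (int n * (i div int n) + i mod int n)"
    by simp
  also have "\<dots> = \<alpha> powi (i mod int n)"
    using root by (subst power_int_add) (simp_all add: power_int_mult primitive_root_of_unity_def)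
  finally show ?thesis ..
qed

lemma root_powi_eq_1_iff: "\<alpha> powi i = 1 \<longleftrightarrow> int n dvd i"
proof -
  define k where "k = nat (i mod int n)"
  have "\<alpha> powi i = \<alpha> ^ k"
    using n_gt_2 by (simp flip: root_powi_mod[of i] add: power_int_nonneg_exp k_def)
  moreover have "k < n"
    using n_gt_2 by (simp add: nat_less_iff k_def)
  then have "\<alpha> ^ k = 1 \<longleftrightarrow> k = 0"
    using root by (cases "k = 0") (simp_all add: primitive_root_of_unity_def)
  moreover have "i mod int n \<ge> 0"
    using n_gt_2 by simp
  then have "k = 0 \<longleftrightarrow> int n dvd i"
    by (auto simp: k_def dvd_eq_mod_eq_0)
  ultimately show ?thesis
    by simp
qed

lemma root_powi_eq_iff: "\<alpha> powi i = \<alpha> powi j \<longleftrightarrow> [i = j] (mod int n)"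
  using root_powi_eq_1_iff[of "i - j"]
  by (simp add: power_int_diff cong_iff_dvd_diff)

lemma bij_betw_root_powi: "bij_betw (\<lambda>i. \<alpha> powi i) (Zmod n) (UNIV - {0})"
proof -
  have inj: "inj_on (\<lambda>i. \<alpha> powi i) (Zmod n)"
    by (auto intro!: inj_onI simp: root_powi_eq_iff cong_def)
  moreover have "card ((\<lambda>i. \<alpha> powi i) ` Zmod n) = card (UNIV - {0 :: 'a})"
    unfolding card_image[OF inj] by (simp add: card_nonzero)
  then have "(\<lambda>i. \<alpha> powi i) ` Zmod n = UNIV - {0}"
    by (intro card_subset_eq) auto
  ultimately show ?thesis
    by (simp add: bij_betw_def)
qed

lemma power_n [simp]: "g ^ n = 1" if "(g :: 'a) \<noteq> 0"
proof -
  have "g \<in> (\<lambda>i. \<alpha> powi i) ` Zmod n"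
    using that by (simp add: bij_betw_imp_surj_on[OF bij_betw_root_powi])
  then obtain i where "g = \<alpha> powi i" ..
  then have "g ^ n = (\<alpha> ^ n) powi i"
    by (simp add: power_int_power power_int_power' mult.commute)
  then show ?thesis
    using root by (simp add: primitive_root_of_unity_def)
qed

lemma power_card [simp]: "(g :: 'a) ^ 2 ^ m = g"
  by (cases "g = 0") (simp_all flip: Suc_n)

lemma of_nat_n: "of_nat n = (1 :: 'a)"
proof -
  have "of_nat (Suc n) = (0 :: 'a)"
    unfolding Suc_n using m_ge_2 by (simp add: two_eq_0 power_0_left)
  then have "of_nat n = - (1 :: 'a)"
    by (metis add.commute add_eq_0_iff of_nat_Suc minus_minus)
  then show ?thesis by simp
qed

text \<open>If \<open>n\<close> does not divide \<open>j\<close>, replacing \<open>g\<close> by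
  \<open>\<alpha> * g\<close> scales the sum by \<open>\<alpha> ^ j\<close>, which is not 1. If it
  does and \<open>j > 0\<close>, the \<open>n\<close> nonzero elements contribute 1 each, and
  \<open>n\<close> is odd. Exponent 0 is excluded because \<open>0 ^ 0 = 1\<close> adds one more
  term, giving the even number \<open>2 ^ m\<close>.\<close>

lemma sum_powers: "(\<Sum>g\<in>UNIV. (g :: 'a) ^ j) = of_bool (0 < j \<and> n dvd j)"
proof (cases "0 < j \<and> n dvd j")
  case True
  then obtain q where q: "j = n * q"
    by (auto elim: dvdE)
  have "(\<Sum>g\<in>UNIV. (g :: 'a) ^ j) = 0 ^ j + (\<Sum>g\<in>UNIV - {0}. g ^ j)"
    by (simp add: sum.remove)
  also have "(\<Sum>g\<in>UNIV - {0}. (g :: 'a) ^ j) = (\<Sum>g\<in>UNIV - {0 :: 'a}. 1)"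
    by (intro sum.cong) (auto simp: q power_mult)
  also have "\<dots> = of_nat n"
    by (simp add: card_nonzero)
  finally show ?thesis
    using True by (simp add: of_nat_n)
next
  case False
  show ?thesis
  proof (cases "j = 0")
    case True
    then show ?thesis
      using m_ge_2 by (simp add: card_UNIV_field two_eq_0 power_0_left)
  next
    case j: False
    have "bij ((*) \<alpha>)"
      by (rule bijI') (auto intro: exI[of _ "_ / \<alpha>"])
    then have "(\<Sum>g\<in>UNIV. (g :: 'a) ^ j) = (\<Sum>g\<in>UNIV. (\<alpha> * g) ^ j)"
      by (rule sum.reindex_bij_betw[symmetric])
    also have "\<dots> = \<alpha> ^ j * (\<Sum>g\<in>UNIV. g ^ j)"
      by (simp add: power_mult_distrib sum_distrib_left)
    finally have "\<alpha> ^ j = 1 \<or> (\<Sum>g\<in>UNIV. (g :: 'a) ^ j) = 0"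
      by auto
    moreover have "\<alpha> ^ j \<noteq> 1"
      using False j root_powi_eq_1_iff[of "int j"] by simp
    ultimately show ?thesis
      using False by auto
  qed
qed

section \<open>Linear combinations and bases over the prime field\<close>

definition combination :: "('j \<Rightarrow> 'a) \<Rightarrow> 'j set \<Rightarrow> ('j \<Rightarrow> bit) \<Rightarrow> 'a" where
  "combination e Q x = (\<Sum>q\<in>Q. of_bit (x q) * e q)"

lemma combination_add: "combination e Q (x + y) = combination e Q x + combination e Q y"
  by (simp only: combination_def plus_fun_apply of_bit_add distrib_right sum.distrib)

lemma combination_mono_neutral:
  "finite Q' \<Longrightarrow> Q \<subseteq> Q' \<Longrightarrow> x \<in> words Q \<Longrightarrow> combination e Q' x = combination e Q x"
  unfolding combination_def by (rule sum.mono_neutral_right) (auto simp: words_def)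

lemma combination_reindex:
  "bij_betw h Q' Q \<Longrightarrow> combination (e \<circ> h) Q' (x \<circ> h) = combination e Q x"
  unfolding combination_def
  using sum.reindex_bij_betw[of h Q' Q "\<lambda>q. of_bit (x q) * e q"] by simp

text \<open>Bases are encoded as unique solvability over words on \<open>Q\<close>, the form that
  \<open>information_set_kernel\<close> requires of a syndrome; repeated vectors are ruled out by
  uniqueness.\<close>

definition field_basis :: "('j \<Rightarrow> 'a) \<Rightarrow> 'j set \<Rightarrow> bool" where
  "field_basis e Q \<longleftrightarrow> finite Q \<and> (\<forall>v. \<exists>!x. x \<in> words Q \<and> combination e Q x = v)"

text \<open>Counting replaces spanning: there are \<open>2 ^ m\<close> words on \<open>Q\<close> and
  as many field elements, so an injective combination map is onto.\<close>

lemma field_basisI: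
  assumes "finite Q" "card Q = m"
    and indep: "\<And>x. x \<in> words Q \<Longrightarrow> combination e Q x = 0 \<Longrightarrow> x = 0"
  shows "field_basis e Q"
proof -
  have inj: "inj_on (combination e Q) (words Q)"
  proof (rule inj_onI)
    fix x y assume xy: "x \<in> words Q" "y \<in> words Q" "combination e Q x = combination e Q y"
    then have "x + y = 0"
      by (intro indep) (auto simp: combination_add words_def)
    then show "x = y"
      by (rule word_add_eq_0)
  qed
  have "combination e Q ` words Q = UNIV"
    using assms by (intro card_subset_eq)
      (auto simp: card_image[OF inj] card_words card_UNIV_field)
  then have "\<exists>!x. x \<in> words Q \<and> combination e Q x = v" for v
  proof -
    have "v \<in> combination e Q ` words Q"
      using \<open>combination e Q ` words Q = UNIV\<close> by simp
    then obtain x where x: "x \<in> words Q" "v = combination e Q x" ..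
    then show ?thesis
      by (intro ex1I[of _ x]) (auto dest: inj_onD[OF inj])
  qed
  with assms(1) show ?thesis
    by (simp add: field_basis_def)
qed

lemma field_basis_reindex:
  assumes h: "bij_betw h Q' Q" and "field_basis (e \<circ> h) Q'" "card Q' = m"
  shows "field_basis e Q"
proof (rule field_basisI)
  show "finite Q" "card Q = m"
    using assms bij_betw_finite[OF h] bij_betw_same_card[OF h] by (auto simp: field_basis_def)
  fix x assume x: "x \<in> words Q" "combination e Q x = 0"
  define y where "y = (\<lambda>q. if q \<in> Q' then x (h q) else 0)"
  have "combination (e \<circ> h) Q' y = combination (e \<circ> h) Q' (x \<circ> h)"
    by (simp add: combination_def y_def)
  with x have "combination (e \<circ> h) Q' y = 0"
    by (simp add: combination_reindex[OF h])
  moreover have "y \<in> words Q'" "0 \<in> words Q'" "combination (e \<circ> h) Q' 0 = 0"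
    by (simp_all add: y_def words_def combination_def)
  ultimately have "y = 0"
    using assms(2) unfolding field_basis_def by metis
  show "x = 0"
  proof
    fix q show "x q = 0 q"
    proof (cases "q \<in> Q")
      case True
      then obtain q' where "q' \<in> Q'" "q = h q'"
        using bij_betw_imp_surj_on[OF h] by blast
      with fun_cong[OF \<open>y = 0\<close>, of q'] show ?thesis
        by (simp add: y_def)
    qed (use x in \<open>auto simp: words_def\<close>)
  qed
qed

text \<open>An additive map is linear over the prime field, hence determined by its values on a
  basis.\<close>

lemma field_basis_additive_eq_0:
  assumes "field_basis e Q" and add: "\<And>x y. L (x + y) = (L x + L y :: 'a)"
    and zero: "\<And>q. q \<in> Q \<Longrightarrow> L (e q) = 0"
  shows "L g = 0"
proof -
  obtain x where x: "g = combination e Q x"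
    using assms(1) unfolding field_basis_def by metis
  have L0: "L 0 = 0"
    using add[of 0 0] by simp
  then have sum: "L (sum f A) = (\<Sum>i\<in>A. L (f i))" for f :: "'j \<Rightarrow> 'a" and A
    by (induction A rule: infinite_finite_induct) (auto simp: add)
  have "L (of_bit b * e q) = 0" if "q \<in> Q" for b q
    using that zero L0 by (cases "b = 0") auto
  then show ?thesis
    unfolding x combination_def sum by (intro sum.neutral ballI)
qed

end

section \<open>Reed-Muller codes of order \<open>1\<close> and \<open>m - 2\<close>\<close>

\<comment> \<open>These rules turn the ring operations on \<^typ>\<open>bit\<close> into bitwise ones, which blocks ring lemmas.\<close>
declare add_bit_eq_xor [simp del] mult_bit_eq_and [simp del]

section \<open>Binary expansions and 2-weights\<close>

lemma bit_nat_less: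
  fixes i :: nat
  assumes "i < 2 ^ m" "bit i j"
  shows "j < m"
proof -
  have "bit (take_bit m i) j"
    using assms by (simp add: take_bit_nat_eq_self)
  then show ?thesis
    by (simp add: bit_take_bit_iff)
qed

lemma sum_bits:
  fixes i :: nat
  assumes "i < 2 ^ m"
  shows "(\<Sum>j | bit i j. 2 ^ j) = i"
proof -
  have "i = (\<Sum>j = 0..<m. push_bit j (of_bool (bit i j)))"
    using assms by (simp flip: take_bit_sum add: take_bit_nat_eq_self)
  also have "\<dots> = (\<Sum>j | bit i j. 2 ^ j)"
    using bit_nat_less[OF assms]
    by (intro sum.mono_neutral_cong_right) (auto simp: push_bit_eq_mult)
  finally show ?thesis ..
qed

lemma wt_0 [simp]: "wt 0 = 0"
  by (simp add: wt_def)

lemma wt_power2 [simp]: "wt (2 ^ k) = 1"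
proof -
  have "{i. bit (2 ^ k :: nat) i} = {k}"
    by (auto simp: bit_exp_iff)
  then show ?thesis
    by (simp add: wt_def)
qed

lemma wt_less_2:
  assumes "wt i < 2"
  shows "i = 0 \<or> (\<exists>k. i = 2 ^ k)"
proof -
  have i: "(\<Sum>j | bit i j. 2 ^ j) = i"
    by (rule sum_bits) (rule less_exp)
  have "finite {j. bit i j}"
    by (rule finite_subset[of _ "{..<i}"]) (auto dest: bit_nat_less[OF less_exp])
  then consider "{j. bit i j} = {}" | k where "{j. bit i j} = {k}"
    using assms by (auto simp: wt_def less_2_cases_iff card_1_singleton_iff)
  then show ?thesis
    using i by cases auto
qed

text \<open>Subtracting \<open>2 ^ k\<close> from the all-ones number \<open>mask m\<close> involves
  no borrow; it merely clears bit \<open>k\<close>.\<close>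

lemma wt_ones_minus_power2:
  assumes "k < m"
  shows "wt (2 ^ m - 1 - 2 ^ k) = m - 1"
proof -
  have "unset_bit k (mask m) + 2 ^ k = (mask m :: nat)"
    using assms
    by (subst disjunctive_add_eq_or) (auto intro!: bit_eqI simp: bit_simps bit_mask_iff bit_exp_iff)
  then have "2 ^ m - 1 - 2 ^ k = (unset_bit k (mask m) :: nat)"
    by (metis diff_add_inverse2 mask_eq_exp_minus_1)
  then have "{i. bit (2 ^ m - 1 - 2 ^ k :: nat) i} = {..<m} - {k}"
    by (auto simp: bit_unset_bit_iff bit_mask_iff)
  with assms show ?thesis
    by (simp add: wt_def)
qed

text \<open>The bits of \<open>2 ^ m - 1 - i\<close> are the positions below \<open>m\<close>
  missing from \<open>i\<close>: at most one by the weight bound, at least one because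
  \<open>i\<close> is not all ones.\<close>

lemma wt_ge_imp_complement:
  assumes "i < 2 ^ m - 1" "m - 1 \<le> wt i"
  shows "\<exists>k<m. 2 ^ m - 1 - i = 2 ^ k"
proof -
  define S where "S = {j. bit i j}"
  have S: "S \<subseteq> {..<m}"
    using assms(1) bit_nat_less[of i m] by (auto simp: S_def)
  have "(\<Sum>j<m. 2 ^ j) = (2 ^ m - 1 :: nat)"
    by (simp add: mask_eq_sum_exp_nat[of m, unfolded lessThan_def[symmetric]])
  moreover have "(\<Sum>j\<in>S. 2 ^ j) = i"
    unfolding S_def using assms(1) by (intro sum_bits[of _ m]) simp
  ultimately have diff: "(\<Sum>j\<in>{..<m} - S. 2 ^ j) = 2 ^ m - 1 - i"
    using S by (simp add: sum_diff_nat finite_subset)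
  with assms(1) have "{..<m} - S \<noteq> {}"
    by (metis sum.empty zero_less_diff less_irrefl)
  moreover have "card ({..<m} - S) \<le> 1"
    using assms(2) S by (simp add: card_Diff_subset finite_subset wt_def S_def)
  ultimately have "card ({..<m} - S) = 1"
    by (intro antisym) (simp_all add: Suc_le_eq card_gt_0_iff)
  then obtain k where k: "{..<m} - S = {k}"
    by (rule card_1_singletonE)
  then have "k < m" by blast
  moreover have "2 ^ m - 1 - i = 2 ^ k"
    using diff unfolding k by simp
  ultimately show ?thesis
    by blast
qed

context binary_field
begin

section \<open>The maps \<open>phi\<close> and the codes as their common zeros\<close>

lemma phi_add: "phi i (x + y) = (phi i x + phi i y :: 'a)"
  by (simp only: phi_def plus_fun_apply of_bit_add distrib_right sum.distrib)

lemma phi_0: "phi 0 x = (of_bit (sum x UNIV) :: 'a)"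
proof -
  have "of_bit (sum x A) = (\<Sum>g\<in>A. of_bit (x g) :: 'a)" for A
    by (induction A rule: infinite_finite_induct) (simp_all add: of_bit_add)
  then show ?thesis
    by (simp add: phi_def)
qed

lemma phi_power2: "phi (2 ^ k) x = (phi 1 x :: 'a) ^ 2 ^ k"
  by (simp add: phi_def frobenius_sum power_mult_distrib)

lemma RM_m_minus_2: "(RM (m - 2) m :: ('a \<Rightarrow> bit) set) = {x. phi 0 x = 0 \<and> phi 1 x = 0}"
proof -
  have "m - (m - 2) = 2"
    using m_ge_2 by simp
  moreover have "phi i x = 0" if "wt i < 2" "phi 0 x = 0" "phi 1 x = (0 :: 'a)" for i x
    using wt_less_2[OF that(1)] that(2,3) by (auto simp: phi_power2)
  \<comment> \<open>The exponents 0 and 1 lie below \<open>n\<close>, so both checks do occur among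
    those defining \<open>RM (m - 2) m\<close>.\<close>
  moreover have "0 < n" "1 < n" "wt 0 < 2" "wt 1 < 2"
    using n_gt_2 wt_power2[of 0] by simp_all
  ultimately show ?thesis
    unfolding RM_def n_eq[symmetric] by (intro Collect_cong) metis
qed

lemma power_Suc_n: "(g :: 'a) ^ Suc n = g"
  unfolding Suc_n by (rule power_card)

text \<open>This inverts the power sums. The kernel sum over \<open>j\<close> is the quotient of
  \<open>g ^ Suc n - h ^ Suc n\<close> by \<open>g - h\<close>, hence 1 for
  \<open>h \<noteq> g\<close> because \<open>g ^ Suc n = g\<close>; for \<open>h = g\<close> it is
  \<open>of_nat (Suc n) * g ^ n = 0\<close>. Adding \<open>phi 0 x\<close> turns this kernel into
  the indicator of \<open>h = g\<close>.\<close>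

lemma phi_interpolation:
  "of_bit (x g) = phi 0 x + (\<Sum>j\<le>n. g ^ j * phi (n - j) x :: 'a)"
proof -
  have inner: "(\<Sum>j\<le>n. g ^ j * h ^ (n - j)) = 1 + of_bool (h = g)" for h :: 'a
  proof (cases "h = g")
    case True
    then have "(\<Sum>j\<le>n. g ^ j * h ^ (n - j)) = of_nat (Suc n) * g ^ n"
      by (simp flip: power_add)
    also have "\<dots> = 0"
      by (simp add: of_nat_n)
    finally show ?thesis
      using True by simp
  next
    case False
    have "(g - h) * (\<Sum>j\<le>n. g ^ j * h ^ (n - j)) = g - h"
      using diff_power_eq_sum[of g n h] unfolding lessThan_Suc_atMost power_Suc_n ..
    with False show ?thesis
      by simp
  qed
  have "(\<Sum>j\<le>n. g ^ j * phi (n - j) x) = (\<Sum>h\<in>UNIV. of_bit (x h) * (\<Sum>j\<le>n. g ^ j * h ^ (n - j)))"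
    unfolding phi_def sum_distrib_left by (subst sum.swap) (simp only: ac_simps)
  also have "\<dots> = (\<Sum>h\<in>UNIV. of_bit (x h) + (if h = g then of_bit (x h) else 0))"
    unfolding inner by (intro sum.cong) (auto simp: distrib_left)
  also have "\<dots> = phi 0 x + of_bit (x g)"
    by (simp add: sum.distrib phi_def)
  finally show ?thesis
    by (simp flip: add.assoc)
qed

text \<open>In the interpolation formula \<open>phi (n - j) x\<close> can survive only if
  \<open>n - j = n\<close> or \<open>wt (n - j) \<ge> m - 1\<close>, that is, for
  \<open>j = 0\<close> or \<open>j\<close> a power of 2. The exponent \<open>n\<close> lies outside
  the defining conditions, and \<open>phi n x\<close> becomes the constant term.\<close>

lemma RM_1_affine:
  assumes "x \<in> (RM 1 m :: ('a \<Rightarrow> bit) set)"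
  shows "of_bit (x g) = phi n x + (\<Sum>k<m. g ^ 2 ^ k * phi (n - 2 ^ k) x :: 'a)"
proof -
  have phi: "phi i x = (0 :: 'a)" if "i < n" "wt i < m - 1" for i
    using assms that by (simp add: RM_def n_eq)
  let ?P = "(\<lambda>k. 2 ^ k :: nat) ` {..<m}"
  have "(2::nat) ^ k \<le> n" if "k < m" for k
    using that power_strict_increasing[of k m "2::nat"] by (simp flip: less_Suc_eq_le add: Suc_n)
  then have sub: "insert 0 ?P \<subseteq> {..n}"
    by auto
  have "(\<Sum>j\<le>n. g ^ j * phi (n - j) x :: 'a) = (\<Sum>j\<in>insert 0 ?P. g ^ j * phi (n - j) x)"
  proof (rule sum.mono_neutral_right[OF _ sub], simp, rule ballI)
    fix j assume j: "j \<in> {..n} - insert 0 ?P"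
    then have "n - (n - j) \<notin> ?P" "n - j < n"
      by auto
    have "wt (n - j) < m - 1"
    proof (rule ccontr)
      assume "\<not> wt (n - j) < m - 1"
      then obtain k where "k < m" "n - (n - j) = 2 ^ k"
        using wt_ge_imp_complement[of "n - j" m] \<open>n - j < n\<close> unfolding n_eq[symmetric] not_less
        by blast
      with \<open>n - (n - j) \<notin> ?P\<close> show False
        by simp
    qed
    then show "g ^ j * phi (n - j) x = (0 :: 'a)"
      using phi \<open>n - j < n\<close> by simp
  qed
  also have "\<dots> = phi n x + (\<Sum>j\<in>?P. g ^ j * phi (n - j) x)"
    by (subst sum.insert) auto
  also have "(\<Sum>j\<in>?P. g ^ j * phi (n - j) x :: 'a) = (\<Sum>k<m. g ^ 2 ^ k * phi (n - 2 ^ k) x)"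
    by (subst sum.reindex) (auto intro: inj_onI)
  moreover have "phi 0 x = (0 :: 'a)"
    using m_ge_2 n_gt_2 by (intro phi) auto
  ultimately show ?thesis
    by (simp add: phi_interpolation)
qed

section \<open>The trace form\<close>

definition trace :: "'a \<Rightarrow> 'a" where
  "trace y = (\<Sum>k<m. y ^ 2 ^ k)"

lemma trace_add: "trace (x + y) = trace x + trace y"
  by (simp add: trace_def frobenius_add sum.distrib)

text \<open>Squaring permutes the \<open>m\<close> conjugates of \<open>y\<close> cyclically, so the
  trace is a root of \<open>t * (t - 1)\<close>.\<close>

lemma trace_cases: "trace y = 0 \<or> trace y = 1"
proof -
  obtain m' where m': "m = Suc m'"
    using m_ge_2 by (cases m) auto
  have "trace y ^ 2 = (\<Sum>k<m. y ^ 2 ^ Suc k)"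
    unfolding trace_def using frobenius_sum[where k = 1 and A = "{..<m}" and f = "\<lambda>k. y ^ 2 ^ k"]
    by (simp flip: power_mult add: mult.commute)
  also have "\<dots> = (\<Sum>k<m'. y ^ 2 ^ Suc k) + y ^ 2 ^ 0"
    using power_card[of y] by (simp add: m' del: power_Suc)
  also have "\<dots> = trace y"
    unfolding trace_def unfolding m' sum.lessThan_Suc_shift by (simp add: add.commute)
  finally have "trace y * (trace y - 1) = 0"
    by (simp add: algebra_simps power2_eq_square)
  then show ?thesis
    by auto
qed

text \<open>Multiplying by \<open>g ^ (n - 1)\<close> and summing over the field extracts the linear
  coefficient of \<open>trace (c * g)\<close> as a polynomial in \<open>g\<close>, which is
  \<open>c\<close>: among the exponents \<open>2 ^ k + (n - 1)\<close> with \<open>k < m\<close>,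
  only \<open>k = 0\<close> gives a multiple of \<open>n\<close>.\<close>

lemma trace_nondegenerate:
  assumes "\<And>g. trace (c * g) = 0"
  shows "c = 0"
proof -
  have exp: "n dvd 2 ^ k + (n - 1) \<longleftrightarrow> k = 0" if "k < m" for k
  proof
    assume "n dvd 2 ^ k + (n - 1)"
    then obtain q where q: "2 ^ k + (n - 1) = n * q"
      by (auto elim: dvdE)
    have "2 ^ k < Suc n"
      unfolding Suc_n using that by simp
    then have "n * q < n * 2"
      using q n_gt_2 by linarith
    then have "q = 0 \<or> q = 1"
      by auto
    then have "(2 :: nat) ^ k = 1"
      using q n_gt_2 by (auto split: nat_diff_split_asm)
    then show "k = 0"
      by simp
  qed (use n_gt_2 in auto)
  have "0 = (\<Sum>g\<in>UNIV. trace (c * g) * g ^ (n - 1))"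
    using assms by simp
  also have "\<dots> = (\<Sum>g\<in>UNIV. \<Sum>k<m. c ^ 2 ^ k * g ^ (2 ^ k + (n - 1)))"
    by (simp add: trace_def sum_distrib_right power_mult_distrib power_add mult.assoc)
  also have "\<dots> = (\<Sum>k<m. c ^ 2 ^ k * (\<Sum>g\<in>UNIV. g ^ (2 ^ k + (n - 1))))"
    by (subst sum.swap) (simp add: sum_distrib_left)
  also have "\<dots> = (\<Sum>k<m. if k = 0 then c ^ 2 ^ k else 0)"
  proof (intro sum.cong refl)
    fix k assume "k \<in> {..<m}"
    then have "n dvd 2 ^ k + (n - 1) \<longleftrightarrow> k = 0"
      by (intro exp) simp
    then show "c ^ 2 ^ k * (\<Sum>g\<in>UNIV. g ^ (2 ^ k + (n - 1))) = (if k = 0 then c ^ 2 ^ k else 0)"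
      unfolding sum_powers by simp
  qed
  also have "\<dots> = c"
    using m_ge_2 by simp
  finally show ?thesis ..
qed

text \<open>Expanding \<open>phi i x\<close> leaves power sums with exponents
  \<open>2 ^ k + i\<close> and \<open>i\<close>. The former is a multiple of \<open>n\<close> only
  for \<open>i = n - 2 ^ k\<close>, whose weight \<open>m - 1\<close> is just too large for a
  check.\<close>

lemma RM_1_trace:
  fixes b :: bit
  assumes x: "\<And>g. of_bit (x g) = trace (c * g) + of_bit b"
  shows "x \<in> RM 1 m"
proof -
  have "phi i x = (0 :: 'a)" if i: "i < n" "wt i < m - 1" for i
  proof -
    have ndvd: "\<not> n dvd 2 ^ k + i" if "k < m" for k
    proof
      assume "n dvd 2 ^ k + i"
      then obtain q where q: "2 ^ k + i = n * q"
        by (auto elim: dvdE)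
      have "2 ^ k < Suc n"
        unfolding Suc_n using that by simp
      then have "n * q < n * 2"
        using q i by linarith
      then have "q = 0 \<or> q = 1"
        by auto
      then have "i = n - 2 ^ k"
        using q by auto
      then show False
        using i wt_ones_minus_power2[OF that] by (simp add: n_eq)
    qed
    have "phi i x = (\<Sum>g\<in>UNIV. \<Sum>k<m. c ^ 2 ^ k * g ^ (2 ^ k + i)) + of_bit b * (\<Sum>g\<in>UNIV. g ^ i)"
      unfolding phi_def x
      by (simp add: trace_def sum_distrib_right power_mult_distrib power_add mult.assoc
          distrib_right sum.distrib sum_distrib_left)
    also have "(\<Sum>g\<in>UNIV. \<Sum>k<m. c ^ 2 ^ k * g ^ (2 ^ k + i)) = (\<Sum>k<m. c ^ 2 ^ k * (\<Sum>g\<in>UNIV. g ^ (2 ^ k + i)))"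
      by (subst sum.swap) (simp add: sum_distrib_left)
    also have "\<dots> = 0"
      by (intro sum.neutral) (auto simp: sum_powers ndvd)
    also have "(\<Sum>g\<in>UNIV. (g :: 'a) ^ i) = 0"
      using i by (auto simp: sum_powers dest: dvd_imp_le)
    finally show ?thesis by simp
  qed
  then show ?thesis
    by (auto simp: RM_def n_eq)
qed

text \<open>The two halves use different descriptions of the code: a codeword vanishing on these
  positions is an additive map that is zero on a basis, while words with prescribed values are found
  as trace functions plus a constant.\<close>

lemma information_set_RM_1:
  assumes B: "field_basis id B" "0 \<notin> B" "card B = m"
  shows "information_set UNIV (RM 1 m :: ('a \<Rightarrow> bit) set) ({0} \<union> B)"
proof (rule information_setI)
  fix x y assume "x \<in> (RM 1 m :: ('a \<Rightarrow> bit) set)" "y \<in> (RM 1 m :: ('a \<Rightarrow> bit) set)"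
  then show "x + y \<in> RM 1 m"
    by (simp add: RM_def phi_add)
next
  fix x :: "'a \<Rightarrow> bit"
  assume x: "x \<in> RM 1 m" "\<And>i. i \<in> {0} \<union> B \<Longrightarrow> x i = 0"
  define L where "L g = (\<Sum>k<m. g ^ 2 ^ k * phi (n - 2 ^ k) x)" for g :: 'a
  have affine: "of_bit (x g) = phi n x + L g" for g
    unfolding L_def by (rule RM_1_affine[OF x(1)])
  have "L 0 = 0"
    by (simp add: L_def power_0_left)
  with affine[of 0] x(2)[of 0] have "phi n x = (0 :: 'a)"
    by simp
  with affine have xL: "of_bit (x g) = L g" for g
    by simp
  have "L g = 0" for g
  proof (rule field_basis_additive_eq_0[OF B(1), where L = L])
    show "L (u + v) = L u + L v" for u v
      by (simp add: L_def frobenius_add distrib_right sum.distrib)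
    show "L (id b) = 0" if "b \<in> B" for b
      using x(2)[of b] that xL[of b] by simp
  qed
  with xL have "of_bit (x g) = (0 :: 'a)" for g
    by simp
  then show "x = 0"
    by (simp add: fun_eq_iff)
next
  fix y :: "'a \<Rightarrow> bit"
  \<comment> \<open>\<open>ev c\<close> lists the values of the linear form
    \<open>g \<mapsto> trace (c * g)\<close> on \<open>B\<close>. It is injective in
    \<open>c\<close> because the trace form is nondegenerate, hence onto \<open>words B\<close> by
    counting.\<close>
  define ev where "ev c = (\<lambda>b. if b \<in> B \<and> trace (c * b) = 1 then 1 else 0 :: bit)" for c
  have inj: "inj ev"
  proof (rule injI)
    fix c c' assume eq: "ev c = ev c'"
    have *: "trace (c * b) = trace (c' * b)" if "b \<in> B" for b
      using fun_cong[OF eq, of b] that trace_cases[of "c * b"] trace_cases[of "c' * b"]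
      by (auto simp: ev_def split: if_splits)
    have "trace ((c + c') * g) = 0" for g
    proof (rule field_basis_additive_eq_0[OF B(1), where L = "\<lambda>g. trace ((c + c') * g)"])
      show "trace ((c + c') * (u + v)) = trace ((c + c') * u) + trace ((c + c') * v)" for u v
        by (simp add: distrib_left trace_add)
      show "trace ((c + c') * id b) = 0" if "b \<in> B" for b
        using *[OF that] by (simp add: distrib_right trace_add)
    qed
    then have "c + c' = 0"
      by (rule trace_nondegenerate)
    then show "c = c'"
      by (simp add: add_eq_0_iff)
  qed
  have "range ev = words B"
  proof (rule card_subset_eq)
    show "card (range ev) = card (words B)"
      by (simp add: card_image[OF inj] card_words card_UNIV_field B(3))
    show "range ev \<subseteq> words B"
      by (auto simp: ev_def words_def)
  qed (simp add: card_words)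
  \<comment> \<open>A linear form vanishes at 0, so the constant \<open>y 0\<close> is first removed
    from the target values and restored in \<open>x\<close>.\<close>
  moreover have "(\<lambda>b. if b \<in> B then y b + y 0 else 0) \<in> words B"
    by (simp add: words_def)
  ultimately obtain c where c: "(\<lambda>b. if b \<in> B then y b + y 0 else 0) = ev c"
    by blast
  define x where "x = (\<lambda>g. (if trace (c * g) = 1 then 1 else 0) + y 0)"
  have "of_bit (x g) = trace (c * g) + of_bit (y 0)" for g
    using trace_cases[of "c * g"] by (auto simp: x_def of_bit_add)
  then have "x \<in> RM 1 m"
    by (rule RM_1_trace)
  moreover have "x i = y i" if "i \<in> {0} \<union> B" for i
  proof (cases "i = 0")
    case True
    then show ?thesis
      by (simp add: x_def trace_def power_0_left)
  next
    case False
    with that have "i \<in> B" by simp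
    then have *: "y i + y 0 = (if trace (c * i) = 1 then 1 else 0)"
      using fun_cong[OF c, of i] by (simp only: ev_def if_True simp_thms)
    have "x i = y i + y 0 + y 0"
      unfolding * x_def ..
    also have "\<dots> = y i"
      by (cases "y i"; cases "y 0") simp_all
    finally show ?thesis .
  qed
  ultimately show "\<exists>x\<in>RM 1 m. \<forall>i\<in>{0} \<union> B. x i = y i"
    by blast
qed auto

text \<open>Position 0 adds nothing to \<open>phi 1\<close>, so the two checks decouple on
  \<open>{0} \<union> B\<close>: the entries on \<open>B\<close> produce the value of
  \<open>phi 1\<close>, then the entry at 0 adjusts the parity.\<close>

lemma information_set_RM_m_minus_2:
  assumes B: "field_basis id B" "0 \<notin> B"
  shows "information_set UNIV (RM (m - 2) m :: ('a \<Rightarrow> bit) set) (UNIV - ({0} \<union> B))"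
proof -
  \<comment> \<open>Parity is recorded as a bit instead of the field element \<open>phi 0 x\<close>,
    because the syndrome must be onto its type.\<close>
  define \<sigma> where "\<sigma> x = (sum x UNIV, phi 1 x)" for x :: "'a \<Rightarrow> bit"
  have phi_1: "phi 1 x = combination id B x" if "x \<in> words ({0} \<union> B)" for x
  proof -
    have "phi 1 x = (\<Sum>g\<in>B. of_bit (x g) * g)"
      unfolding phi_def power_one_right
      using that by (intro sum.mono_neutral_right) (auto simp: words_def)
    then show ?thesis
      by (simp add: combination_def)
  qed
  have "RM (m - 2) m = {x \<in> words UNIV. \<sigma> x = 0}"
    unfolding RM_m_minus_2 by (auto simp: words_def \<sigma>_def phi_0 zero_prod_def)
  moreover have "information_set UNIV {x \<in> words UNIV. \<sigma> x = 0} (UNIV - ({0} \<union> B))"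
  proof (rule information_set_kernel)
    show "\<sigma> (x + y) = \<sigma> x + \<sigma> y" for x y
      by (simp add: \<sigma>_def phi_add sum.distrib)
    fix v :: "bit \<times> 'a"
    obtain p s where v: "v = (p, s)" by fastforce
    obtain z where z: "z \<in> words B" "combination id B z = s"
      using B(1) unfolding field_basis_def by blast
    have unique: "z' = z" if "z' \<in> words B" "combination id B z' = s" for z'
      using B(1) z that unfolding field_basis_def by blast
    have upd: "combination id B (w(0 := q)) = combination id B w" for w q
      unfolding combination_def using B(2) by (intro sum.cong) auto
    have parity: "sum (w(0 := q)) UNIV = q + sum w (UNIV - {0})" for w :: "'a \<Rightarrow> bit" and q
      by (subst sum.remove[of _ 0]) (auto intro!: sum.cong arg_cong2[where f = "(+)"])
    define w where "w = z(0 := p - sum z (UNIV - {0}))"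
    show "\<exists>!z. z \<in> words ({0} \<union> B) \<and> \<sigma> z = v"
    proof (rule ex1I)
      have "w \<in> words ({0} \<union> B)"
        using z(1) by (auto simp: w_def words_def)
      moreover have "sum w UNIV = p"
        unfolding w_def parity by (rule diff_add_cancel)
      moreover have "combination id B w = s"
        unfolding w_def upd by (rule z)
      ultimately show "w \<in> words ({0} \<union> B) \<and> \<sigma> w = v"
        using phi_1[of w] by (simp add: \<sigma>_def v)
    next
      fix w' assume w': "w' \<in> words ({0} \<union> B) \<and> \<sigma> w' = v"
      then have "w'(0 := 0) = z"
        using phi_1[of w'] by (intro unique) (auto simp: words_def upd \<sigma>_def v)
      then have eq: "w' = z(0 := w' 0)"
        by auto
      have "w' 0 + sum z (UNIV - {0}) = p"
        using w' parity[of z "w' 0"] eq unfolding \<sigma>_def v by simp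
      then have "w' 0 = p - sum z (UNIV - {0})"
        by (simp only: eq_diff_eq)
      with eq show "w' = w"
        by (simp only: w_def)
    qed
  qed auto
  ultimately show ?thesis by simp
qed

end

section \<open>The punctured code and its defining set\<close>

context binary_field
begin

text \<open>An even \<open>s\<close> is halved by injectivity of squaring. For odd \<open>s\<close>,
  the polynomial \<open>(X + 1) ^ s - X ^ s - 1\<close> has degree at most \<open>s < 2 ^ m\<close>
  and \<open>2 ^ m\<close> roots, so it is zero; its derivative at 0 then forces
  \<open>s = 1\<close>.\<close>

lemma additive_power_imp_power2:
  assumes "0 < s" "s < 2 ^ m" "\<And>y. (y + 1 :: 'a) ^ s = y ^ s + 1"
  shows "\<exists>k. s = 2 ^ k"
  using assms
proof (induction s rule: less_induct)
  case (less s)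
  show ?case
  proof (cases "even s")
    case True
    then obtain t where t: "s = 2 * t"
      by (auto elim: evenE)
    have "(y + 1) ^ t = y ^ t + 1" for y :: 'a
    proof -
      have "((y + 1) ^ t + (y ^ t + 1)) ^ 2 ^ 1 = (y + 1) ^ s + (y ^ s + 1)"
        unfolding frobenius_add t by (simp flip: power_mult add: mult.commute)
      also have "\<dots> = 0"
        using less.prems(3)[of y] by simp
      finally show ?thesis
        by (simp add: add_eq_0_iff)
    qed
    then have "\<exists>k. t = 2 ^ k"
      using less.prems t by (intro less.IH) auto
    then show ?thesis
      using t power_Suc by metis
  next
    case False
    then obtain t where t: "s = Suc t" "even t"
      by (cases s) auto
    then have s_1: "of_nat s = (1 :: 'a)"
      by (auto elim!: evenE simp: two_eq_0)
    define p where "p = [:1, 1 :: 'a:] ^ s - Polynomial.monom 1 s - 1"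
    have "degree p \<le> s"
      unfolding p_def
      by (intro degree_diff_le) (auto simp: degree_monom_le intro: order_trans[OF degree_power_le])
    moreover have "poly p y = 0" for y
      using less.prems(3)[of y] by (simp add: p_def poly_monom add.commute)
    ultimately have "p = 0"
      using less.prems(2) by (intro poly_eqI_degree[of UNIV]) (auto simp: card_UNIV_field)
    then have "poly (pderiv p) 0 = 0"
      by simp
    then have "1 + 0 ^ t = (0 :: 'a)"
      using s_1 unfolding p_def t(1)
      by (simp add: pderiv_diff pderiv_power_Suc pderiv_monom poly_monom pderiv_pCons del: of_nat_Suc power_Suc)
    then have "t = 0"
      by (cases "t = 0") (auto simp: power_0_left)
    then have "s = 2 ^ 0"
      using t by simp
    then show ?thesis ..
  qed
qed

section \<open>The punctured code as a Hamming code\<close>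

definition hamming :: "(int \<Rightarrow> bit) set" where
  "hamming = {P \<in> words (Zmod n). combination (\<lambda>i. \<alpha> powi i) (Zmod n) P = 0}"

lemma combination_powers_reindex:
  "combination (\<lambda>i. \<alpha> powi i) (Zmod n) (\<lambda>i. x (\<alpha> powi i)) = phi 1 x"
proof -
  have "combination (\<lambda>i. \<alpha> powi i) (Zmod n) (\<lambda>i. x (\<alpha> powi i)) = (\<Sum>g\<in>UNIV - {0}. of_bit (x g) * g)"
    unfolding combination_def by (rule sum.reindex_bij_betw[OF bij_betw_root_powi])
  also have "\<dots> = phi 1 x"
    unfolding phi_def power_one_right by (intro sum.mono_neutral_left) auto
  finally show ?thesis .
qed

lemma punctured_RM_m_minus_2: "to_cyclic n \<alpha> ` punctured_RM (m - 2) m = hamming"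
proof (intro equalityI subsetI)
  fix P assume "P \<in> to_cyclic n \<alpha> ` punctured_RM (m - 2) m"
  then obtain x where x: "phi 1 x = (0 :: 'a)" "P = to_cyclic n \<alpha> (x(0 := 0))"
    by (auto simp: punctured_RM_def RM_m_minus_2)
  have "combination (\<lambda>i. \<alpha> powi i) (Zmod n) P = combination (\<lambda>i. \<alpha> powi i) (Zmod n) (\<lambda>i. x (\<alpha> powi i))"
    unfolding combination_def x(2) by (intro sum.cong) (auto simp: to_cyclic_def)
  then show "P \<in> hamming"
    using x(1) unfolding combination_powers_reindex
    by (auto simp: hamming_def x(2) to_cyclic_def words_def)
next
  fix P assume P: "P \<in> hamming"
  define y where "y g = P (the_inv_into (Zmod n) (\<lambda>i. \<alpha> powi i) g)" for g
  \<comment> \<open>The entry at 0 is the parity bit that extends a Hamming word to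
    \<open>RM (m - 2) m\<close>; puncturing removes it again.\<close>
  define x where "x = y(0 := sum y (UNIV - {0}))"
  have y: "y (\<alpha> powi i) = P i" if "i \<in> Zmod n" for i
    using that bij_betw_root_powi by (simp add: y_def the_inv_into_f_f bij_betw_def)
  have "sum x UNIV = x 0 + sum x (UNIV - {0})"
    by (simp add: sum.remove)
  also have "sum x (UNIV - {0}) = x 0"
    unfolding x_def by (auto intro: sum.cong)
  also have "x 0 + x 0 = 0"
    by (cases "x 0") simp_all
  finally have "phi 0 x = (0 :: 'a)"
    by (simp add: phi_0)
  moreover have "phi 1 x = combination (\<lambda>i. \<alpha> powi i) (Zmod n) P"
    unfolding combination_powers_reindex[symmetric] combination_def
    by (intro sum.cong) (auto simp: x_def y)
  ultimately have "x \<in> RM (m - 2) m"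
    using P by (simp add: RM_m_minus_2 hamming_def)
  moreover have "P = to_cyclic n \<alpha> (x(0 := 0))"
    using P by (auto simp: to_cyclic_def fun_eq_iff x_def y hamming_def words_def)
  ultimately show "P \<in> to_cyclic n \<alpha> ` punctured_RM (m - 2) m"
    unfolding punctured_RM_def by blast
qed

lemma check_positions_hamming:
  assumes "K \<subseteq> Zmod n" "field_basis (\<lambda>i. \<alpha> powi i) K"
  shows "check_positions (Zmod n) hamming K"
proof -
  have "information_set (Zmod n) hamming (Zmod n - K)"
    unfolding hamming_def
  proof (rule information_set_kernel)
    have "combination (\<lambda>i. \<alpha> powi i) (Zmod n) x = combination (\<lambda>i. \<alpha> powi i) K x" if "x \<in> words K" for x
      using that assms(1) by (intro combination_mono_neutral) auto
    then show "\<exists>!z. z \<in> words K \<and> combination (\<lambda>i. \<alpha> powi i) (Zmod n) z = v" for v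
      using assms(2) unfolding field_basis_def by metis
  qed (use assms in \<open>auto simp: combination_add\<close>)
  with assms(1) show ?thesis
    by (simp add: check_positions_def)
qed

lemma poly_eval_root_powi:
  "poly_eval n P (\<alpha> powi int s) = (\<Sum>i\<in>Zmod n. of_bit (P i) * (\<alpha> powi i) ^ s)"
proof -
  have "(\<alpha> powi int s) powi i = (\<alpha> powi i) ^ s" for i
    by (metis power_int_mult power_int_of_nat mult.commute)
  then show ?thesis
    by (simp only: poly_eval_def)
qed

text \<open>Powers of 2 belong to it by Frobenius. Codewords of weight three suffice to exclude
  every other exponent, through \<open>additive_power_imp_power2\<close>.\<close>

lemma cyclic_defining_set_hamming:
  "cyclic_defining_set n \<alpha> hamming = (\<lambda>k. 2 ^ k) ` {..<m}"
proof (intro equalityI subsetI)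
  fix s assume "s \<in> (\<lambda>k. 2 ^ k :: int) ` {..<m}"
  then obtain k where k: "k < m" "s = int (2 ^ k)"
    by auto
  have "(2 :: nat) ^ k \<le> 2 ^ (m - 1)"
    using k(1) by (intro power_increasing) auto
  moreover have "2 * 2 ^ (m - 1) = (2 :: nat) ^ m"
    using m_ge_2 by (simp flip: power_Suc)
  ultimately have "2 ^ k < n"
    using Suc_n n_gt_2 by linarith
  moreover have "poly_eval n P (\<alpha> powi s) = 0" if "P \<in> hamming" for P
  proof -
    have "poly_eval n P (\<alpha> powi s) = combination (\<lambda>i. \<alpha> powi i) (Zmod n) P ^ 2 ^ k"
      unfolding k(2) poly_eval_root_powi combination_def frobenius_sum
      by (simp add: power_mult_distrib)
    then show ?thesis
      using that by (simp add: hamming_def)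
  qed
  ultimately show "s \<in> cyclic_defining_set n \<alpha> hamming"
    by (simp add: cyclic_defining_set_def k(2))
next
  fix s' assume "s' \<in> cyclic_defining_set n \<alpha> hamming"
  then obtain s where s: "s' = int s" "s < n" "\<And>P. P \<in> hamming \<Longrightarrow> poly_eval n P (\<alpha> powi int s) = 0"
    by (auto simp: cyclic_defining_set_def elim!: nonneg_int_cases)
  txt \<open>The words of weight three with locators \<open>1\<close>, \<open>y\<close> and \<open>y + 1\<close> show that \<open>y \<mapsto> y ^ s\<close> is additive.\<close>
  have additive: "1 + (y ^ s + (y + 1) ^ s) = 0" if "y \<noteq> 0" "y \<noteq> 1" for y :: 'a
  proof -
    have "y + 1 \<noteq> 0" "y + 1 \<noteq> y" "y + 1 \<noteq> 1"
      using that by (auto simp: add_eq_0_iff)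
    have "y \<in> (\<lambda>i. \<alpha> powi i) ` Zmod n" "y + 1 \<in> (\<lambda>i. \<alpha> powi i) ` Zmod n"
      using that \<open>y + 1 \<noteq> 0\<close> by (simp_all add: bij_betw_imp_surj_on[OF bij_betw_root_powi])
    then obtain i j where ij: "i \<in> Zmod n" "y = \<alpha> powi i" "j \<in> Zmod n" "y + 1 = \<alpha> powi j"
      by blast
    have distinct: "i \<noteq> 0" "j \<noteq> 0" "i \<noteq> j"
      using that ij \<open>y + 1 \<noteq> y\<close> \<open>y + 1 \<noteq> 1\<close> by auto
    define P where "P = (\<lambda>t. if t \<in> {0, i, j} then 1 else 0 :: bit)"
    have sum_P: "(\<Sum>t\<in>Zmod n. of_bit (P t) * f t) = f 0 + (f i + f j)" for f :: "int \<Rightarrow> 'a"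
    proof -
      have "(\<Sum>t\<in>Zmod n. of_bit (P t) * f t) = (\<Sum>t\<in>{0, i, j}. f t)"
        using ij n_gt_2 by (intro sum.mono_neutral_cong_right) (auto simp: P_def)
      also have "\<dots> = f 0 + (f i + f j)"
        using distinct by simp
      finally show ?thesis .
    qed
    have "combination (\<lambda>i. \<alpha> powi i) (Zmod n) P = 1 + (y + (y + 1))"
      unfolding combination_def sum_P ij(2,4)[symmetric] by simp
    also have "\<dots> = 0"
      by (simp flip: add.assoc)
    finally have "P \<in> hamming"
      using ij n_gt_2 unfolding hamming_def by (auto simp: words_def P_def)
    from s(3)[OF this] show ?thesis
      unfolding poly_eval_root_powi sum_P by (simp flip: ij(2,4))
  qed
  \<comment> \<open>\<open>\<alpha>\<close> serves as an admissible \<open>y\<close>; for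
    \<open>s = 0\<close> the three terms would add up to 1 instead of 0.\<close>
  have "\<alpha> \<noteq> 1"
    using root_powi_eq_1_iff[of 1] n_gt_2 by auto
  then have "1 + (\<alpha> ^ s + (\<alpha> + 1) ^ s) = 0"
    by (intro additive) simp_all
  then have "s \<noteq> 0"
    by (intro notI) (simp only: power_0 add_self add_0_right one_neq_zero)
  moreover have "(y + 1) ^ s = y ^ s + 1" for y :: 'a
  proof (cases "y = 0 \<or> y = 1")
    case True
    with \<open>s \<noteq> 0\<close> show ?thesis
      by (auto simp: power_0_left)
  next
    case False
    then have "(y + 1) ^ s + (y ^ s + 1) = 0"
      using additive[of y] by (simp add: ac_simps)
    then show ?thesis
      by (simp add: add_eq_0_iff)
  qed
  moreover have "s < 2 ^ m"
    using s(2) Suc_n by simp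
  ultimately obtain k where "s = 2 ^ k"
    using additive_power_imp_power2[of s] by auto
  moreover from this \<open>s < 2 ^ m\<close> have "k < m"
    by simp
  ultimately show "s' \<in> (\<lambda>k. 2 ^ k) ` {..<m}"
    by (auto simp: s(1))
qed

end

section \<open>The splitting \<open>n = r\<^sub>1 r\<^sub>2\<close>\<close>

text \<open>Hypothesis \<open>exp\<close> says that \<open>2 ^ \<gamma>\<close> has order
  \<open>c\<close> modulo \<open>r\<close>. The unit \<open>e\<close> cancels, so the coset is as
  large as this order.\<close>

lemma card_cyclo_coset:
  assumes "coprime e (int r)" "0 < c" "0 < r"
    and exp: "\<And>i j. [2 ^ (\<gamma> * i) = 2 ^ (\<gamma> * j)] (mod r) \<longleftrightarrow> [i = j] (mod c)"
  shows "card (cyclo_coset \<gamma> r e) = c"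
proof -
  define f where "f i = (e * 2 ^ (\<gamma> * i)) mod int r" for i
  have eq: "f i = f j \<longleftrightarrow> [i = j] (mod c)" for i j
  proof -
    have "f i = f j \<longleftrightarrow> [e * 2 ^ (\<gamma> * i) = e * 2 ^ (\<gamma> * j)] (mod int r)"
      by (simp add: f_def cong_def)
    also have "\<dots> \<longleftrightarrow> [int (2 ^ (\<gamma> * i)) = int (2 ^ (\<gamma> * j))] (mod int r)"
      using assms(1) by (simp add: cong_mult_lcancel)
    finally show ?thesis
      by (simp only: cong_int_iff exp)
  qed
  have "cyclo_coset \<gamma> r e = f ` {..<c}"
  proof (intro equalityI subsetI)
    fix x assume "x \<in> cyclo_coset \<gamma> r e"
    then obtain i where "x = f i"
      by (auto simp: cyclo_coset_def f_def)
    then have "x = f (i mod c)"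
      by (simp add: eq)
    then show "x \<in> f ` {..<c}"
      using assms(2) by simp
  qed (auto simp: cyclo_coset_def f_def)
  moreover have "inj_on f {..<c}"
    by (auto intro!: inj_onI simp: eq cong_def)
  ultimately show ?thesis
    by (simp add: card_image)
qed

lemma period_le:
  assumes "0 < r" "\<And>i j. [x ^ (\<gamma> * i) = x ^ (\<gamma> * j)] (mod r) \<longleftrightarrow> [i = j] (mod c)"
  shows "c \<le> (r :: nat)"
proof -
  have "inj_on (\<lambda>i. x ^ (\<gamma> * i) mod r) {..<c}"
    using assms(2) by (auto intro!: inj_onI simp: cong_def)
  moreover have "(\<lambda>i. x ^ (\<gamma> * i) mod r) ` {..<c} \<subseteq> {..<r}"
    using assms(1) by auto
  ultimately have "card {..<c} \<le> card {..<r}"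
    by (intro card_inj_on_le) auto
  then show ?thesis
    by simp
qed

locale split_binary_field = binary_field \<alpha> m n
  for \<alpha> :: "'a::{finite,field}" and m n :: nat +
  fixes r1 r2 :: nat and T :: "int \<Rightarrow> int \<times> int" and a b :: nat and \<delta>1 \<delta>2 :: int
  assumes n_split: "n = r1 * r2"
    and odd_r: "odd r1" "odd r2" and coprime_r: "coprime r1 r2"
    and r1_gt_1: "1 < r1" and r2_gt_1: "1 < r2"
    and T_iso: "T \<in> iso (integer_mod_group n) (integer_mod_group r1 \<times>\<times> integer_mod_group r2)"
    and a_def: "a = ord r1 2" and b_def: "b = m div a"
    and T_1: "T 1 = (\<delta>1, \<delta>2)"
begin

section \<open>Orders of 2 modulo \<open>n\<close>, \<open>r1\<close> and \<open>r2\<close>\<close>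

lemma pow2_cong_n: "[2 ^ i = 2 ^ j] (mod n) \<longleftrightarrow> [i = j] (mod m)"
proof -
  have coprime: "coprime n 2"
    using odd_r by (simp add: n_split)
  have "ord n 2 dvd m"
    unfolding ord_divides[symmetric] Suc_n[symmetric] using n_gt_2 by (simp add: cong_def mod_Suc)
  \<comment> \<open>A smaller order \<open>d\<close> would place \<open>2 ^ d\<close> between 2 and
    \<open>n\<close>, where no number below \<open>n\<close> is congruent to 1 and \<open>n\<close>
    itself is odd.\<close>
  moreover have "m \<le> ord n 2"
  proof (rule ccontr)
    assume "\<not> m \<le> ord n 2"
    then have "2 ^ ord n 2 < Suc n"
      unfolding Suc_n by simp
    moreover have "[2 ^ ord n 2 = 1] (mod n)"
      by (rule ord)
    moreover have "1 \<le> ord n 2"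
      using coprime ord_gt_0_iff[of n 2] by linarith
    then have "(2::nat) ^ 1 \<le> 2 ^ ord n 2" "even ((2::nat) ^ ord n 2)"
      using coprime by - (intro power_increasing, simp_all)
    ultimately have "2 ^ ord n 2 = n"
      using n_gt_2 by (cases "2 ^ ord n 2 < n") (auto simp: cong_def)
    with \<open>even (2 ^ ord n 2)\<close> have "even n"
      by (simp only:)
    with odd_r show False
      by (simp add: n_split)
  qed
  ultimately have "ord n 2 = m"
    using m_ge_2 by (auto dest: dvd_imp_le)
  with coprime show ?thesis
    by (simp add: order_divides_expdiff)
qed

text \<open>The factor \<open>1\<close> in the exponents keeps the shape that
  \<open>card_cyclo_coset\<close> and \<open>period_le\<close> match with
  \<open>\<gamma> = 1\<close>.\<close>

lemma pow2_cong_r1: "[2 ^ (1 * i) = 2 ^ (1 * j)] (mod r1) \<longleftrightarrow> [i = j] (mod a)"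
  using odd_r unfolding a_def mult_1 by (intro order_divides_expdiff) simp

lemma m_eq: "m = a * b"
proof -
  have "[2 ^ m = 2 ^ 0] (mod n)"
    unfolding pow2_cong_n by (simp add: cong_def)
  then have "[2 ^ m = 2 ^ 0] (mod r1)"
    unfolding n_split by (rule cong_modulus_mult_nat)
  then have "a dvd m"
    using pow2_cong_r1[of m 0] by (simp add: cong_def dvd_eq_mod_eq_0)
  then show ?thesis
    by (simp add: b_def)
qed

lemma a_b_pos: "0 < a" "0 < b"
  using m_eq m_ge_2 by (auto intro: Nat.gr0I)

lemma cong_n_iff: "[x = y] (mod int n) \<longleftrightarrow> [x = y] (mod int r1) \<and> [x = y] (mod int r2)"
  using coprime_r unfolding n_split cong_iff_dvd_diff
  by (auto simp: divides_mult intro: dvd_mult_left dvd_mult_right)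

lemma cong_n_nat_iff: "[x = y] (mod n) \<longleftrightarrow> [x = y] (mod r1) \<and> [x = y] (mod r2)" for x y :: nat
  using cong_n_iff[of "int x" "int y"] by (simp only: cong_int_iff)

text \<open>Powers of \<open>2 ^ a\<close> are all 1 modulo \<open>r1\<close>, so by the Chinese
  remainder theorem their congruence modulo \<open>r2\<close> is congruence modulo \<open>n\<close>.
  Thus \<open>2 ^ a\<close> has order \<open>b\<close> modulo \<open>r2\<close>.\<close>

lemma pow2_cong_r2: "[2 ^ (a * i) = 2 ^ (a * j)] (mod r2) \<longleftrightarrow> [i = j] (mod b)"
proof -
  have "[2 ^ (a * i) = 2 ^ (a * j)] (mod r1)"
    using pow2_cong_r1[of "a * i" "a * j"] by (simp add: cong_def)
  then have "[2 ^ (a * i) = 2 ^ (a * j)] (mod r2) \<longleftrightarrow> [a * i = a * j] (mod m)"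
    by (simp flip: pow2_cong_n add: cong_n_nat_iff)
  also have "\<dots> \<longleftrightarrow> [i = j] (mod b)"
    using a_b_pos by (simp add: m_eq cong_def flip: mult_mod_right)
  finally show ?thesis .
qed

lemma a_le: "a \<le> r1"
  using r1_gt_1 by (intro period_le[OF _ pow2_cong_r1]) simp

lemma b_le: "b \<le> r2"
  using r2_gt_1 by (intro period_le[OF _ pow2_cong_r2]) simp

section \<open>The isomorphism \<open>T\<close> in coordinates\<close>

lemma bij_betw_T: "bij_betw T (Zmod n) (Zmod r1 \<times> Zmod r2)"
  using T_iso n_gt_2 r1_gt_1 r2_gt_1 by (auto simp: iso_def carrier_integer_mod_group)

text \<open>A homomorphism is determined by the image of the generator 1; reduction modulo
  \<open>n\<close> is harmless since \<open>r1\<close> and \<open>r2\<close> divide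
  \<open>n\<close>.\<close>

lemma T_mod: "T (i mod int n) = ((i * \<delta>1) mod int r1, (i * \<delta>2) mod int r2)"
proof -
  let ?G = "integer_mod_group n" and ?H = "integer_mod_group r1 \<times>\<times> integer_mod_group r2"
  have hom: "T \<in> hom ?G ?H"
    using T_iso by (simp add: iso_def)
  have "T 0 = (0, 0)"
    using hom_one[OF hom] by (simp add: DirProd_group)
  moreover have add: "T ((i + j) mod int n) = ((fst (T i) + fst (T j)) mod int r1, (snd (T i) + snd (T j)) mod int r2)"
    if "i \<in> Zmod n" "j \<in> Zmod n" for i j
    using hom_mult[OF hom, of i j] that n_gt_2
    by (simp add: carrier_integer_mod_group mult_DirProd' split: prod.splits)
  ultimately have nat: "T (int k) = ((int k * \<delta>1) mod int r1, (int k * \<delta>2) mod int r2)" if "k < n" for k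
    using that
  proof (induction k)
    case (Suc k)
    then have "T (int (Suc k)) = T ((int k + 1) mod int n)"
      by (simp add: add.commute)
    also have "\<dots> = ((int (Suc k) * \<delta>1) mod int r1, (int (Suc k) * \<delta>2) mod int r2)"
      using Suc n_gt_2 by (subst add) (auto simp: T_1 mod_simps algebra_simps)
    finally show ?case .
  qed simp
  have "T (i mod int n) = T (int (nat (i mod int n)))"
    using n_gt_2 by simp
  also have "\<dots> = ((i mod int n * \<delta>1) mod int r1, (i mod int n * \<delta>2) mod int r2)"
    using n_gt_2 by (subst nat) (simp_all add: nat_less_iff)
  also have "\<dots> = ((i * \<delta>1) mod int r1, (i * \<delta>2) mod int r2)"
    by (simp add: n_split mod_mod_cancel mod_mult_cong[OF mod_mod_cancel refl])
  finally show ?thesis .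
qed

text \<open>\<open>u1\<close> and \<open>u2\<close> are the preimages of the unit vectors, so the
  inverse of \<open>T\<close> is \<open>(i, j) \<mapsto> i * u1 + j * u2\<close> modulo
  \<open>n\<close>.\<close>

definition u1 :: int where "u1 = the_inv_into (Zmod n) T (1, 0)"
definition u2 :: int where "u2 = the_inv_into (Zmod n) T (0, 1)"

lemma u_cong:
  "[u1 * \<delta>1 = 1] (mod int r1)" "[u1 * \<delta>2 = 0] (mod int r2)"
  "[u2 * \<delta>1 = 0] (mod int r1)" "[u2 * \<delta>2 = 1] (mod int r2)"
proof -
  have inj: "inj_on T (Zmod n)" and mem: "(1, 0) \<in> T ` Zmod n" "(0, 1) \<in> T ` Zmod n"
    using bij_betw_T r1_gt_1 r2_gt_1 by (simp_all add: bij_betw_def)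
  have "T u1 = (1, 0)" "u1 \<in> Zmod n" "T u2 = (0, 1)" "u2 \<in> Zmod n"
    unfolding u1_def u2_def
    using f_the_inv_into_f[OF inj mem(1)] the_inv_into_into[OF inj mem(1) subset_refl]
      f_the_inv_into_f[OF inj mem(2)] the_inv_into_into[OF inj mem(2) subset_refl] .
  with T_mod[of u1] T_mod[of u2] show
    "[u1 * \<delta>1 = 1] (mod int r1)" "[u1 * \<delta>2 = 0] (mod int r2)"
    "[u2 * \<delta>1 = 0] (mod int r1)" "[u2 * \<delta>2 = 1] (mod int r2)"
    using r1_gt_1 r2_gt_1 by (simp_all add: cong_def)
qed

lemma coprime_\<delta>: "coprime \<delta>1 (int r1)" "coprime \<delta>2 (int r2)"
  using u_cong by (metis coprime_iff_invertible_int mult.commute)+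

text \<open>\<open>u1\<close> is a unit modulo \<open>r1\<close> and 0 modulo \<open>r2\<close>; for
  \<open>u2\<close> the roles are exchanged.\<close>

lemma u_mult_cong_iff:
  "[u1 * x = u1 * y] (mod int n) \<longleftrightarrow> [x = y] (mod int r1)"
  "[u2 * x = u2 * y] (mod int n) \<longleftrightarrow> [x = y] (mod int r2)"
proof -
  have "coprime u1 (int r1)" "coprime u2 (int r2)"
    using u_cong by (metis coprime_iff_invertible_int)+
  moreover have "[u1 = 0] (mod int r2)" "[u2 = 0] (mod int r1)"
    using u_cong coprime_\<delta> by (metis cong_mult_rcancel mult_zero_left)+
  then have "[u1 * x = u1 * y] (mod int r2)" "[u2 * x = u2 * y] (mod int r1)"
    by (auto simp: cong_0_iff cong_iff_dvd_diff simp flip: right_diff_distrib)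
  ultimately show
    "[u1 * x = u1 * y] (mod int n) \<longleftrightarrow> [x = y] (mod int r1)"
    "[u2 * x = u2 * y] (mod int n) \<longleftrightarrow> [x = y] (mod int r2)"
    by (simp_all add: cong_n_iff cong_mult_lcancel)
qed

text \<open>The locator at the position that \<open>T\<close> sends to \<open>(i, j)\<close> is
  \<open>\<gamma>1 ^ i * \<gamma>2 ^ j\<close>.\<close>

definition \<gamma>1 :: 'a where "\<gamma>1 = \<alpha> powi u1"
definition \<gamma>2 :: 'a where "\<gamma>2 = \<alpha> powi u2"

lemma \<gamma>1_power_eq_iff: "\<gamma>1 ^ i = \<gamma>1 ^ j \<longleftrightarrow> [i = j] (mod r1)"
  by (simp add: \<gamma>1_def root_powi_eq_iff u_mult_cong_iff cong_int_iff flip: power_int_of_nat power_int_mult)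

lemma \<gamma>2_power_eq_iff: "\<gamma>2 ^ i = \<gamma>2 ^ j \<longleftrightarrow> [i = j] (mod r2)"
  by (simp add: \<gamma>2_def root_powi_eq_iff u_mult_cong_iff cong_int_iff flip: power_int_of_nat power_int_mult)

text \<open>
  An \<open>F\<^sub>2\<close>-relation among the products \<open>\<gamma>1 ^ i * \<gamma>2 ^ j\<close> is a polynomial in \<open>\<gamma>2\<close> of degree less
  than \<open>b\<close> with coefficients in the subfield with \<open>2 ^ a\<close> elements, so it also vanishes at the \<open>b\<close>
  conjugates \<open>\<gamma>2 ^ 2 ^ (a * t)\<close>.  Each coefficient is a polynomial in \<open>\<gamma>1\<close> of degree less than \<open>a\<close>
  that vanishes at the \<open>a\<close> conjugates \<open>\<gamma>1 ^ 2 ^ t\<close>.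
\<close>

lemma field_basis_products:
  "field_basis (\<lambda>(i, j). \<gamma>1 ^ i * \<gamma>2 ^ j) ({..<a} \<times> {..<b})"
proof (rule field_basisI)
  fix x assume x: "x \<in> words ({..<a} \<times> {..<b})"
    "combination (\<lambda>(i, j). \<gamma>1 ^ i * \<gamma>2 ^ j) ({..<a} \<times> {..<b}) x = 0"
  define p where "p j = (\<Sum>i<a. of_bit (x (i, j)) * \<gamma>1 ^ i)" for j
  have p_power: "p j ^ 2 ^ t = (\<Sum>i<a. of_bit (x (i, j)) * (\<gamma>1 ^ 2 ^ t) ^ i)" for j t
    unfolding p_def frobenius_sum
    by (simp add: power_mult_distrib mult.commute flip: power_mult)
  have "\<gamma>1 ^ 2 ^ (a * t) = \<gamma>1" for t
    using pow2_cong_r1[of "a * t" 0] \<gamma>1_power_eq_iff[of "2 ^ (a * t)" 1] by (simp add: cong_def)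
  then have p_fixed: "p j ^ 2 ^ (a * t) = p j" for j t
    unfolding p_power by (simp add: p_def)
  have "(\<Sum>j<b. p j * \<gamma>2 ^ j) = combination (\<lambda>(i, j). \<gamma>1 ^ i * \<gamma>2 ^ j) ({..<a} \<times> {..<b}) x"
    unfolding p_def combination_def sum_distrib_right
    by (subst sum.swap, subst sum.cartesian_product) (simp add: case_prod_unfold mult.assoc)
  then have sum_0: "(\<Sum>j<b. p j * \<gamma>2 ^ j) = 0"
    using x by simp
  have p_0: "p j = 0" if "j < b" for j
  proof (rule poly_function_eq_0[of "(\<lambda>t. \<gamma>2 ^ 2 ^ (a * t)) ` {..<b}"])
    \<comment> \<open>These conjugates are distinct because \<open>2 ^ a\<close> has order
      \<open>b\<close> modulo \<open>r2\<close>, the order of \<open>\<gamma>2\<close>.\<close>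
    have "inj_on (\<lambda>t. \<gamma>2 ^ 2 ^ (a * t)) {..<b}"
      by (auto intro!: inj_onI simp: \<gamma>2_power_eq_iff pow2_cong_r2) (simp add: cong_def)
    then show "b \<le> card ((\<lambda>t. \<gamma>2 ^ 2 ^ (a * t)) ` {..<b})"
      by (simp add: card_image)
    fix y assume "y \<in> (\<lambda>t. \<gamma>2 ^ 2 ^ (a * t)) ` {..<b}"
    then obtain t where t: "y = \<gamma>2 ^ 2 ^ (a * t)"
      by blast
    have "(\<Sum>j<b. p j * y ^ j) = (\<Sum>j<b. p j * \<gamma>2 ^ j) ^ 2 ^ (a * t)"
      unfolding frobenius_sum power_mult_distrib p_fixed t
      by (simp add: mult.commute flip: power_mult)
    then show "(\<Sum>j<b. p j * y ^ j) = 0"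
      by (simp add: sum_0)
  qed (use that in auto)
  have x_0: "of_bit (x (i, j)) = (0 :: 'a)" if "i < a" "j < b" for i j
  proof (rule poly_function_eq_0[where c = "\<lambda>i. of_bit (x (i, j))" and A = "(\<lambda>t. \<gamma>1 ^ 2 ^ t) ` {..<a}"])
    have "inj_on (\<lambda>t. \<gamma>1 ^ 2 ^ t) {..<a}"
      using pow2_cong_r1 by (auto intro!: inj_onI simp: \<gamma>1_power_eq_iff) (simp add: cong_def)
    then show "a \<le> card ((\<lambda>t. \<gamma>1 ^ 2 ^ t) ` {..<a})"
      by (simp add: card_image)
    fix y assume "y \<in> (\<lambda>t. \<gamma>1 ^ 2 ^ t) ` {..<a}"
    then obtain t where "y = \<gamma>1 ^ 2 ^ t"
      by blast
    then have "(\<Sum>i<a. of_bit (x (i, j)) * y ^ i) = p j ^ 2 ^ t"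
      by (simp add: p_power)
    then show "(\<Sum>i<a. of_bit (x (i, j)) * y ^ i) = 0"
      by (simp add: p_0[OF that(2)])
  qed (use that in auto)
  show "x = 0"
  proof
    fix q show "x q = 0 q"
      using x(1) x_0[of "fst q" "snd q"] by (cases q) (auto simp: words_def)
  qed
qed (auto simp: m_eq)

text \<open>The bounds \<open>a \<le> r1\<close> and \<open>b \<le> r2\<close> keep the coordinates
  unreduced, so the map inverts \<open>T\<close> on the rectangle.\<close>

lemma bij_betw_T_rectangle:
  "bij_betw (\<lambda>(i, j). (int i * u1 + int j * u2) mod int n) ({..<a} \<times> {..<b})
     {t \<in> Zmod n. T t \<in> {0..<int a} \<times> {0..<int b}}"
proof -
  define h where "h = (\<lambda>(i, j). (int i * u1 + int j * u2) mod int n)"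
  have T_h: "T (h (i, j)) = (int i, int j)" if "i < a" "j < b" for i j
  proof -
    have "[(int i * u1 + int j * u2) * \<delta>1 = int i] (mod int r1)"
      using cong_add[OF cong_scalar_left[OF u_cong(1), of "int i"] cong_scalar_left[OF u_cong(3), of "int j"]]
      by (simp add: algebra_simps)
    moreover have "[(int i * u1 + int j * u2) * \<delta>2 = int j] (mod int r2)"
      using cong_add[OF cong_scalar_left[OF u_cong(2), of "int i"] cong_scalar_left[OF u_cong(4), of "int j"]]
      by (simp add: algebra_simps)
    ultimately show ?thesis
      using that a_le b_le by (simp add: h_def T_mod cong_def)
  qed
  have h_Zmod: "h q \<in> Zmod n" for q
    using n_gt_2 by (cases q) (simp add: h_def)
  have "bij_betw h ({..<a} \<times> {..<b}) {t \<in> Zmod n. T t \<in> {0..<int a} \<times> {0..<int b}}"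
  proof (rule bij_betw_byWitness[where f' = "\<lambda>t. (nat (fst (T t)), nat (snd (T t)))"])
    show "\<forall>q\<in>{..<a} \<times> {..<b}. (nat (fst (T (h q))), nat (snd (T (h q)))) = q"
      by (auto simp: T_h)
    show "h ` ({..<a} \<times> {..<b}) \<subseteq> {t \<in> Zmod n. T t \<in> {0..<int a} \<times> {0..<int b}}"
      using h_Zmod by (auto simp: T_h)
    show "\<forall>t\<in>{t \<in> Zmod n. T t \<in> {0..<int a} \<times> {0..<int b}}. h (nat (fst (T t)), nat (snd (T t))) = t"
    proof
      fix t assume t: "t \<in> {t \<in> Zmod n. T t \<in> {0..<int a} \<times> {0..<int b}}"
      then have "T (h (nat (fst (T t)), nat (snd (T t)))) = T t"
        by (subst T_h) (auto simp: mem_Times_iff nat_less_iff)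
      then show "h (nat (fst (T t)), nat (snd (T t))) = t"
        using t h_Zmod bij_betw_imp_inj_on[OF bij_betw_T] by (auto dest: inj_onD)
    qed
  qed (auto simp: mem_Times_iff nat_less_iff)
  then show ?thesis
    by (simp add: h_def)
qed

lemma field_basis_rectangle:
  defines "K \<equiv> {t \<in> Zmod n. T t \<in> {0..<int a} \<times> {0..<int b}}"
  shows "field_basis (\<lambda>i. \<alpha> powi i) K" "card K = m"
proof -
  let ?h = "\<lambda>(i, j). (int i * u1 + int j * u2) mod int n"
  have "(\<lambda>i. \<alpha> powi i) \<circ> ?h = (\<lambda>(i, j). \<gamma>1 ^ i * \<gamma>2 ^ j)"
  proof
    fix q :: "nat \<times> nat"
    obtain i j where q: "q = (i, j)"
      by fastforce
    have "\<alpha> powi (int i * u1) = \<gamma>1 ^ i" "\<alpha> powi (int j * u2) = \<gamma>2 ^ j"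
      unfolding \<gamma>1_def \<gamma>2_def by (metis mult.commute power_int_mult power_int_of_nat)+
    then show "((\<lambda>i. \<alpha> powi i) \<circ> ?h) q = (\<lambda>(i, j). \<gamma>1 ^ i * \<gamma>2 ^ j) q"
      by (simp add: q root_powi_mod power_int_add)
  qed
  with field_basis_products show "field_basis (\<lambda>i. \<alpha> powi i) K"
    unfolding K_def by (intro field_basis_reindex[OF bij_betw_T_rectangle]) (simp_all add: m_eq)
  show "card K = m"
    using bij_betw_same_card[OF bij_betw_T_rectangle] by (simp add: K_def m_eq)
qed

text \<open>The powers of 2 give one orbit, so \<open>Dbar\<close> is a single pair of units and
  both cyclotomic cosets have full size. Hence \<open>M_val\<close> takes only the value
  \<open>b\<close>, and the staircase \<open>Gamma_set\<close> has one step, of width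
  \<open>a\<close>.\<close>

lemma Gamma_set_eq:
  assumes "restricted_reps r1 r2 (T ` (\<lambda>k. 2 ^ k) ` {..<m}) Dbar"
  shows "Gamma_set r1 r2 Dbar = {0..<int a} \<times> {0..<int b}"
proof -
  define D where "D = T ` (\<lambda>k. 2 ^ k) ` {..<m}"
  have pow_Zmod: "(2 ^ k :: int) \<in> Zmod n" if "k < m" for k
    using that cyclic_defining_set_hamming unfolding cyclic_defining_set_def by blast
  have T_pow: "T (2 ^ k) = ((\<delta>1 * 2 ^ k) mod int r1, (\<delta>2 * 2 ^ k) mod int r2)" if "k < m" for k
    using T_mod[of "2 ^ k"] pow_Zmod[OF that] by (simp add: mult.commute)
  have "T (2 ^ 0) \<in> D"
    using m_ge_2 unfolding D_def by (intro imageI) simp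
  then have T_1_D: "T 1 \<in> D"
    by simp
  have "restricted_reps r1 r2 D Dbar"
    using assms by (simp only: D_def)
  then have Dbar: "Dbar \<subseteq> D" and ex1: "\<exists>!e. e \<in> Dbar \<and> e \<in> orbit2 r1 r2 (T 1)"
    using T_1_D by (simp_all only: restricted_reps_def)
  have "D \<subseteq> orbit2 r1 r2 (T 1)"
    by (auto simp: D_def T_pow orbit2_def T_1)
  with Dbar have "Dbar \<subseteq> orbit2 r1 r2 (T 1)"
    by (rule subset_trans)
  with ex1 obtain e where e: "Dbar = {e}"
    by (metis (no_types, lifting) is_singletonI' is_singleton_def subsetD empty_iff)
  obtain e1 e2 where e12: "e = (e1, e2)"
    by fastforce
  obtain k where "k < m" "e = T (2 ^ k)"
    using e Dbar by (auto simp: D_def)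
  then have "e1 = (\<delta>1 * 2 ^ k) mod int r1" "e2 = (\<delta>2 * 2 ^ k) mod int r2"
    by (simp_all add: T_pow e12)
  then have coprime: "coprime e1 (int r1)" "coprime e2 (int r2)"
    using coprime_\<delta> odd_r r1_gt_1 r2_gt_1 by (simp_all add: coprime_mod_left_iff)
  have m1: "m1 r1 e1 = a"
    unfolding m1_def using coprime a_b_pos r1_gt_1 by (intro card_cyclo_coset pow2_cong_r1) auto
  have m2: "m2 r1 r2 e1 e2 = b"
    unfolding m2_def m1 using coprime a_b_pos r2_gt_1 by (intro card_cyclo_coset pow2_cong_r2) auto
  have M: "M_val r1 r2 Dbar e1 = b"
    unfolding M_val_def e e12 by (simp add: m2)
  have f_seq: "f_seq r1 r2 Dbar = [b]"
    unfolding f_seq_def using M by (simp add: e e12)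
  \<comment> \<open>The second value is the default 0 past the end of the list, so the only step
    starts at \<open>i2 = 0\<close>.\<close>
  have f: "f_val r1 r2 Dbar 1 = b" "f_val r1 r2 Dbar (1 + 1) = 0"
    by (simp_all add: f_val_def f_seq)
  have "{e1'. e1' \<in> fst ` Dbar \<and> f_val r1 r2 Dbar 1 \<le> M_val r1 r2 Dbar e1'} = {e1}"
    using f M by (auto simp: e e12)
  then have g: "g_val r1 r2 Dbar 1 = a"
    unfolding g_val_def by (simp add: m1)
  have j: "1 \<le> j \<and> j \<le> length (f_seq r1 r2 Dbar) \<longleftrightarrow> j = 1" for j
    by (auto simp: f_seq)
  have "Gamma_set r1 r2 Dbar = {(i1, i2) \<in> Zmod r1 \<times> Zmod r2. 0 \<le> i2 \<and> i2 < int b \<and> 0 \<le> i1 \<and> i1 < int a}"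
    unfolding Gamma_set_def conj_assoc[symmetric] j
    unfolding conj_assoc simp_thms f g by simp
  also have "\<dots> = {0..<int a} \<times> {0..<int b}"
    using a_le b_le by auto
  finally show ?thesis .
qed

end

theorem theorem34:
  fixes \<alpha> \<beta>1 \<beta>2 :: "'a::{finite,field}"
    and m n r1 r2 a :: nat
    and T :: "int \<Rightarrow> int \<times> int"
    and \<eta>1 \<eta>2 \<delta>1 \<delta>2 :: int
    and Cstar :: "(int \<Rightarrow> bit) set"
    and Dstar :: "int set"
    and C :: "(int \<times> int \<Rightarrow> bit) set"
    and Dbar \<Gamma> :: "(int \<times> int) set"
  assumes "card (UNIV :: 'a set) = 2 ^ m"
    and "n = 2 ^ m - 1" and "n = r1 * r2"
    and "odd r1" and "odd r2" and "coprime r1 r2" and "r1 > 1" and "r2 > 1"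
    and "primitive_root_of_unity n \<alpha>"
    and "T \<in> iso (integer_mod_group n) (integer_mod_group r1 \<times>\<times> integer_mod_group r2)"
    and "Cstar = to_cyclic n \<alpha> ` punctured_RM (m - 2) m"
    and "a = ord r1 2"
    and "Dstar = cyclic_defining_set n \<alpha> Cstar"
    and "\<eta>1 * int r1 + \<eta>2 * int r2 = 1"
    and "T 1 = (\<delta>1, \<delta>2)"
    and "\<beta>1 = (\<alpha> powi (\<eta>2 * int r2)) powi modular_inverse (int r1) \<delta>1"
    and "\<beta>2 = (\<alpha> powi (\<eta>1 * int r1)) powi modular_inverse (int r2) \<delta>2"
    and "abelian_code r1 r2 C"
    and "defining_set r1 r2 \<beta>1 \<beta>2 C = T ` Dstar"
    and "restricted_reps r1 r2 (defining_set r1 r2 \<beta>1 \<beta>2 C) Dbar"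
    and "\<Gamma> = Gamma_set r1 r2 Dbar"
  shows "\<Gamma> = {(i1, i2) \<in> Zmod r1 \<times> Zmod r2.
               0 \<le> i1 \<and> i1 < int a \<and> 0 \<le> i2 \<and> real_of_int i2 < real m / real a}
       \<and> check_positions (Zmod n) Cstar {i \<in> Zmod n. T i \<in> \<Gamma>}
       \<and> information_set UNIV (RM 1 m :: ('a \<Rightarrow> bit) set)
           ({0} \<union> (\<lambda>i. \<alpha> powi i) ` {i \<in> Zmod n. T i \<in> \<Gamma>})
       \<and> information_set UNIV (RM (m - 2) m :: ('a \<Rightarrow> bit) set)
           ((\<lambda>i. \<alpha> powi i) ` {i \<in> Zmod n. T i \<notin> \<Gamma>})"
proof -
  \<comment> \<open>Two factors above 1 make \<open>n\<close> at least 4, which gives the bound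
    \<open>2 \<le> m\<close> of the locale.\<close>
  have "2 * 2 \<le> r1 * r2"
    using assms(7,8) by (intro mult_mono) auto
  then have "2 ^ 2 \<le> (2 :: nat) ^ m"
    using assms(2,3) by simp
  then have "2 \<le> m"
    by (simp only: power_increasing_iff)
  interpret split_binary_field \<alpha> m n r1 r2 T a "m div a" \<delta>1 \<delta>2
    by unfold_locales (use assms \<open>2 \<le> m\<close> in simp_all)
  let ?K = "{t \<in> Zmod n. T t \<in> {0..<int a} \<times> {0..<int (m div a)}}"
  let ?e = "\<lambda>i. \<alpha> powi i"
  have Cstar: "Cstar = hamming"
    by (simp only: assms(11) punctured_RM_m_minus_2)
  have "defining_set r1 r2 \<beta>1 \<beta>2 C = T ` (\<lambda>k. 2 ^ k) ` {..<m}"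
    by (simp only: assms(13,19) Cstar cyclic_defining_set_hamming)
  then have \<Gamma>: "\<Gamma> = {0..<int a} \<times> {0..<int (m div a)}"
    using assms(20,21) by (simp add: Gamma_set_eq)
  \<comment> \<open>The real quotient in the statement is a natural number because \<open>a\<close>
    divides \<open>m\<close>.\<close>
  have "real m / real a = real (m div a)"
    using a_b_pos by (subst (1) m_eq) simp
  then have rectangle: "\<Gamma> = {(i1, i2) \<in> Zmod r1 \<times> Zmod r2.
      0 \<le> i1 \<and> i1 < int a \<and> 0 \<le> i2 \<and> real_of_int i2 < real m / real a}"
    unfolding \<Gamma> using a_le b_le by auto
  have check: "check_positions (Zmod n) Cstar ?K"
    unfolding Cstar by (intro check_positions_hamming field_basis_rectangle) auto
  have inj: "inj_on ?e (Zmod n)" and img: "?e ` Zmod n = UNIV - {0}"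
    using bij_betw_root_powi by (simp_all add: bij_betw_def)
  have bij: "bij_betw ?e ?K (?e ` ?K)"
    by (intro inj_on_imp_bij_betw inj_on_subset[OF inj]) auto
  have basis: "field_basis id (?e ` ?K)"
    by (rule field_basis_reindex[OF bij]) (simp_all only: id_comp field_basis_rectangle)
  have card: "card (?e ` ?K) = m"
    using bij_betw_same_card[OF bij] field_basis_rectangle(2) by simp
  have nonzero: "0 \<notin> ?e ` ?K"
    by auto
  \<comment> \<open>The powers of \<open>\<alpha>\<close> exhaust the nonzero elements, so the
    remaining locators are the complement of 0 and the check locators.\<close>
  have "?e ` {i \<in> Zmod n. T i \<notin> \<Gamma>} = ?e ` (Zmod n - ?K)"
    unfolding \<Gamma> by (intro arg_cong[where f = "image ?e"]) auto
  also have "\<dots> = ?e ` Zmod n - ?e ` ?K"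
    by (rule inj_on_image_set_diff[OF inj]) auto
  also have "\<dots> = UNIV - ({0} \<union> ?e ` ?K)"
    unfolding img insert_is_Un[symmetric] by (rule Diff_insert2[symmetric])
  finally have compl: "?e ` {i \<in> Zmod n. T i \<notin> \<Gamma>} = UNIV - ({0} \<union> ?e ` ?K)" .
  have K: "{i \<in> Zmod n. T i \<in> \<Gamma>} = ?K"
    by (simp only: \<Gamma>)
  show ?thesis
    unfolding K compl
    using rectangle check information_set_RM_1[OF basis nonzero card]
      information_set_RM_m_minus_2[OF basis nonzero]
    by (intro conjI)
qed

end
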